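(* Let $f\colon S^2\to S^2$ be a Thurston map without periodic critical points and let $\mathcal C\subset S^2$ be a Jordan curve that is invariant under $f$ and contains $\mathrm{post}(f)$. Then there exists a constant $C>0$ such that $D_n=D_n(f,\mathcal C)\le C\deg(f)^{n/2}$ for all $n\ge0$.
   Context: $S^2$ is an oriented topological $2$-sphere. A branched covering map $f\colon S^2\to S^2$ is a continuous map that near each point $p$ has the form $z\mapsto z^{d}$, $d=\deg_f(p)\ge1$, in suitable orientation-preserving local coordinates centered at $p$ and $f(p)$; $p$ is critical if $\deg_f(p)\ge2$. $\deg(f)$ is the number of preimages of a non-critical value. $\mathrm{post}(f)=\bigcup_{n\ge1}\{f^n(c): c\text{ critical point of }f\}$. A Thurston map is a branched covering map with $\deg(f)\ge2$ and $\mathrm{post}(f)$ finite (one without periodic critical points has $\#\mathrm{post}(f)\ge3$). $\mathcal C$ is invariant under $f$ if $f(\mathcal C)\subseteq\mathcal C$. The $n$-tiles are the closures of the connected components of $S^2\setminus f^{-n}(\mathcal C)$. The $0$-edges are the closed arcs into which the points of $\mathrm{post}(f)$ divide $\mathcal C$. A set $K\subseteq S^2$ joins opposite sides of $\mathcal C$ if $\#\mathrm{post}(f)\ge4$ and $K$ meets two disjoint $0$-edges, or $\#\mathrm{post}(f)=3$ and $K$ meets all three $0$-edges. $D_n(f,\mathcal C)$ is the minimal $N\in\mathbb N$ such that there are $n$-tiles $X_1,\dots,X_N$ whose union is connected and joins opposite sides of $\mathcal C$. *)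

theory Defs
  imports "HOL-Complex_Analysis.Complex_Analysis"
begin

section \<open>Oriented topological 2-spheres\<close>

text \<open>
  A homeomorphism \<open>h\<close> from an open set \<open>V\<close> of the complex plane onto another one preserves
  orientation iff every positively oriented circle bounding a closed disk in \<open>V\<close> is mapped to
  a loop winding once, counterclockwise, around the image of the centre.
  (\<open>winding_number\<close> is meaningful for all continuous paths avoiding the point.)
\<close>

definition orientation_preserving_on :: "complex set \<Rightarrow> (complex \<Rightarrow> complex) \<Rightarrow> bool" where
  "orientation_preserving_on V h \<longleftrightarrow>
     (\<forall>z\<in>V. \<forall>r>0. cball z r \<subseteq> V \<longrightarrow> winding_number (h \<circ> circlepath z r) (h z) = 1)"

text \<open>A chart is a pair \<open>(U, \<phi>)\<close>; the values of \<open>\<phi>\<close> outside \<open>U\<close> are irrelevant.\<close>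

type_synonym 'a chart = "'a set \<times> ('a \<Rightarrow> complex)"

definition planar_chart :: "'a topology \<Rightarrow> 'a chart \<Rightarrow> bool" where
  "planar_chart X = (\<lambda>(U, \<phi>). openin X U \<and> open (\<phi> ` U) \<and>
     homeomorphic_map (subtopology X U) (top_of_set (\<phi> ` U)) \<phi>)"

definition orientation_compatible :: "'a chart \<Rightarrow> 'a chart \<Rightarrow> bool" where
  "orientation_compatible = (\<lambda>(U, \<phi>) (V, \<psi>).
     orientation_preserving_on (\<phi> ` (U \<inter> V)) (\<psi> \<circ> inv_into U \<phi>))"

text \<open>An orientation of a surface is given by an atlas with orientation-preserving transitions.\<close>

definition oriented_atlas :: "'a topology \<Rightarrow> 'a chart set \<Rightarrow> bool" where
  "oriented_atlas X A \<longleftrightarrow>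
     (\<forall>c\<in>A. planar_chart X c) \<and> (\<Union>c\<in>A. fst c) = topspace X \<and>
     (\<forall>c\<in>A. \<forall>c'\<in>A. orientation_compatible c c')"

definition oriented_sphere :: "'a topology \<Rightarrow> 'a chart set \<Rightarrow> bool" where
  "oriented_sphere X A \<longleftrightarrow>
     X homeomorphic_space top_of_set (sphere (0 :: real ^ 3) 1) \<and> oriented_atlas X A"

definition positive_chart :: "'a topology \<Rightarrow> 'a chart set \<Rightarrow> 'a chart \<Rightarrow> bool" where
  "positive_chart X A c \<longleftrightarrow> planar_chart X c \<and> (\<forall>c'\<in>A. orientation_compatible c c')"


section \<open>Branched covering maps and Thurston maps\<close>

definition local_power_form ::
  "'a topology \<Rightarrow> 'a chart set \<Rightarrow> ('a \<Rightarrow> 'a) \<Rightarrow> 'a \<Rightarrow> nat \<Rightarrow> bool" where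
  "local_power_form X A f p d \<longleftrightarrow> d \<ge> 1 \<and>
     (\<exists>U \<phi> V \<psi>. positive_chart X A (U, \<phi>) \<and> positive_chart X A (V, \<psi>) \<and>
        p \<in> U \<and> \<phi> p = 0 \<and> f p \<in> V \<and> \<psi> (f p) = 0 \<and>
        f ` U \<subseteq> V \<and> (\<forall>x\<in>U. \<psi> (f x) = \<phi> x ^ d))"

definition branched_covering_map ::
  "'a topology \<Rightarrow> 'a chart set \<Rightarrow> ('a \<Rightarrow> 'a) \<Rightarrow> bool" where
  "branched_covering_map X A f \<longleftrightarrow>
     continuous_map X X f \<and> (\<forall>p\<in>topspace X. \<exists>d. local_power_form X A f p d)"

text \<open>
  The exponent in the local form is unique: it is the number of preimages close to \<open>p\<close> of points
  close to, but different from, \<open>f p\<close>.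
\<close>

definition local_degree ::
  "'a topology \<Rightarrow> 'a chart set \<Rightarrow> ('a \<Rightarrow> 'a) \<Rightarrow> 'a \<Rightarrow> nat" where
  "local_degree X A f p = (THE d. local_power_form X A f p d)"

definition critical_points ::
  "'a topology \<Rightarrow> 'a chart set \<Rightarrow> ('a \<Rightarrow> 'a) \<Rightarrow> 'a set" where
  "critical_points X A f = {p \<in> topspace X. local_degree X A f p \<ge> 2}"

text \<open>
  For a branched covering map of the sphere, the number of preimages is the same for all
  non-critical values (and there are such values, the critical points being finite in number).
\<close>

definition map_degree ::
  "'a topology \<Rightarrow> 'a chart set \<Rightarrow> ('a \<Rightarrow> 'a) \<Rightarrow> nat" where
  "map_degree X A f =
     (THE d. \<forall>q \<in> topspace X - f ` critical_points X A f. card {x \<in> topspace X. f x = q} = d)"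

definition post :: "'a topology \<Rightarrow> 'a chart set \<Rightarrow> ('a \<Rightarrow> 'a) \<Rightarrow> 'a set" where
  "post X A f = (\<Union>n\<in>{1..}. (f ^^ n) ` critical_points X A f)"

definition Thurston_map :: "'a topology \<Rightarrow> 'a chart set \<Rightarrow> ('a \<Rightarrow> 'a) \<Rightarrow> bool" where
  "Thurston_map X A f \<longleftrightarrow>
     branched_covering_map X A f \<and> map_degree X A f \<ge> 2 \<and> finite (post X A f)"

definition no_periodic_critical_points ::
  "'a topology \<Rightarrow> 'a chart set \<Rightarrow> ('a \<Rightarrow> 'a) \<Rightarrow> bool" where
  "no_periodic_critical_points X A f \<longleftrightarrow>
     (\<forall>c\<in>critical_points X A f. \<forall>n\<ge>1. (f ^^ n) c \<noteq> c)"


section \<open>Tiles, edges, and joining opposite sides\<close>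

definition Jordan_curve_in :: "'a topology \<Rightarrow> 'a set \<Rightarrow> bool" where
  "Jordan_curve_in X J \<longleftrightarrow> J \<subseteq> topspace X \<and>
     subtopology X J homeomorphic_space top_of_set (sphere (0 :: complex) 1)"

definition tiles :: "'a topology \<Rightarrow> ('a \<Rightarrow> 'a) \<Rightarrow> 'a set \<Rightarrow> nat \<Rightarrow> 'a set set" where
  "tiles X f J n = (\<lambda>K. X closure_of K) `
     connected_components_of (subtopology X (topspace X - {x \<in> topspace X. (f ^^ n) x \<in> J}))"

text \<open>The arcs into which \<open>post X A f\<close> divides \<open>J\<close>: closures of the complementary components.\<close>

definition zero_edges ::
  "'a topology \<Rightarrow> 'a chart set \<Rightarrow> ('a \<Rightarrow> 'a) \<Rightarrow> 'a set \<Rightarrow> 'a set set" where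
  "zero_edges X A f J = (\<lambda>K. X closure_of K) `
     connected_components_of (subtopology X (J - post X A f))"

definition joins_opposite_sides ::
  "'a topology \<Rightarrow> 'a chart set \<Rightarrow> ('a \<Rightarrow> 'a) \<Rightarrow> 'a set \<Rightarrow> 'a set \<Rightarrow> bool" where
  "joins_opposite_sides X A f J K \<longleftrightarrow>
     card (post X A f) \<ge> 4 \<and>
       (\<exists>e\<in>zero_edges X A f J. \<exists>e'\<in>zero_edges X A f J.
          e \<inter> e' = {} \<and> K \<inter> e \<noteq> {} \<and> K \<inter> e' \<noteq> {}) \<or>
     card (post X A f) = 3 \<and> (\<forall>e\<in>zero_edges X A f J. K \<inter> e \<noteq> {})"

definition D ::
  "'a topology \<Rightarrow> 'a chart set \<Rightarrow> ('a \<Rightarrow> 'a) \<Rightarrow> 'a set \<Rightarrow> nat \<Rightarrow> nat" where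
  "D X A f J n = (LEAST N. \<exists>T :: nat \<Rightarrow> 'a set.
     (\<forall>i\<in>{1..N}. T i \<in> tiles X f J n) \<and>
     connectedin X (\<Union>i\<in>{1..N}. T i) \<and>
     joins_opposite_sides X A f J (\<Union>i\<in>{1..N}. T i))"

end

theory Submission
  imports Defs
begin

text \<open>
  Choose \<open>E\<close>, \<open>B\<close>, \<open>G\<close>, \<open>B'\<close> in cyclic order on the curve such that a set meeting \<open>E\<close> and \<open>G\<close>, or
  \<open>E\<close>, \<open>B\<close> and \<open>B'\<close>, joins opposite sides. Let \<open>N = D\<^sub>n\<close>. For \<open>1 < i < N\<close> the \<open>n\<close>-tiles at
  combinatorial distance \<open>i\<close> from \<open>E\<close> separate \<open>E\<close> from \<open>G\<close> in the sphere, so a component of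
  their union separates \<open>E\<close> from \<open>G\<close> and hence meets \<open>B\<close> and \<open>B'\<close>; adding a chain of \<open>i - 1\<close>
  tiles that leads back to \<open>E\<close> gives a set that joins opposite sides. So there are at least
  \<open>N - i + 1\<close> tiles at distance \<open>i\<close>, and at least about \<open>N\<^sup>2 / 2\<close> tiles altogether. On the
  other hand, the interior of every \<open>n\<close>-tile is mapped by the \<open>n\<close>-th iterate onto a complementary
  domain of the curve and therefore contains an \<open>n\<close>-th preimage of one of two fixed points off
  the curve, so there are at most \<open>2 deg(f)\<^sup>n\<close> tiles.
\<close>

section \<open>Topology of the sphere\<close>

lemma homeomorphic_space_top_of_set:
  "top_of_set S homeomorphic_space top_of_set T \<longleftrightarrow> S homeomorphic T"
proof
  assume "top_of_set S homeomorphic_space top_of_set T"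
  then obtain f g where "homeomorphic_maps (top_of_set S) (top_of_set T) f g"
    unfolding homeomorphic_space_def by blast
  then have "homeomorphism S T f g"
    by (intro homeomorphismI) (auto simp: homeomorphic_maps_def)
  then show "S homeomorphic T" by (auto simp: homeomorphic_def)
next
  assume "S homeomorphic T"
  then obtain f g where "homeomorphism S T f g" by (auto simp: homeomorphic_def)
  then have "homeomorphic_maps (top_of_set S) (top_of_set T) f g"
    by (auto simp: homeomorphic_maps_def homeomorphism_def)
  then show "top_of_set S homeomorphic_space top_of_set T" by (auto simp: homeomorphic_space_def)
qed

locale topological_sphere =
  fixes X :: "'a topology"
  assumes homeomorphic_sphere: "X homeomorphic_space top_of_set (sphere (0 :: real ^ 3) 1)"
begin

lemma compact_sphere: "compact_space X"
  using homeomorphic_compact_space[OF homeomorphic_sphere] by (simp add: compact_space_subtopology)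

lemma Hausdorff_sphere: "Hausdorff_space X"
  using homeomorphic_Hausdorff_space[OF homeomorphic_sphere] by (simp add: Hausdorff_space_subtopology)

lemma connected_space_sphere: "connected_space X"
proof -
  have "connected (sphere (0::real^3) 1)" by (simp add: connected_sphere)
  then show ?thesis using homeomorphic_connected_space[OF homeomorphic_sphere]
    by (simp add: connectedin_def flip: connectedin_iff_connected)
qed

lemma locally_connected_sphere: "locally_connected_space X"
proof -
  have "locally path_connected (sphere (0::real^3) 1)"
    by (rule locally_path_connected_sphere)
  then have "locally connected (sphere (0::real^3) 1)"
    using locally_mono path_connected_imp_connected by blast
  \<comment> \<open>Local connectedness of a set and of an abstract topology are matched by
    unfolding both into neighbourhoods.\<close>
  then have "locally_connected_space (top_of_set (sphere (0::real^3) 1))"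
    unfolding locally_def locally_connected_space_def neighbourhood_base_of_def neighbourhood_base_at_def
      connectedin_subtopology topspace_euclidean_subtopology connectedin_iff_connected
    by (meson openin_imp_subset subset_trans)
  then show ?thesis using homeomorphic_locally_connected_space[OF homeomorphic_sphere] by simp
qed

text \<open>Stereographic projection. All planar results used below, including the Jordan curve
  theorem, reach the sphere through this homeomorphism.\<close>

lemma puncture_homeomorphic_plane:
  assumes "p \<in> topspace X"
  obtains h where "homeomorphic_map (subtopology X (topspace X - {p})) (euclidean :: complex topology) h"
proof -
  let ?S = "sphere (0 :: real ^ 3) 1"
  obtain s where s: "homeomorphic_map X (top_of_set ?S) s"
    using homeomorphic_sphere homeomorphic_space by blast
  have sp: "s p \<in> ?S" using homeomorphic_imp_surjective_map[OF s] assms by auto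
  have "inj_on s (topspace X)" using homeomorphic_imp_injective_map[OF s] .
  then have 1: "homeomorphic_map (subtopology X (topspace X - {p})) (subtopology (top_of_set ?S) (?S - {s p})) s"
    using assms by (intro homeomorphic_map_subtopologies_alt[OF s]) (auto dest: inj_onD)
  let ?T = "{x::real^3. axis 1 1 \<bullet> x = 0}"
  have "(?S - {s p}) homeomorphic ?T"
    by (rule homeomorphic_punctured_sphere_hyperplane) (use sp in auto)
  also have "?T homeomorphic (UNIV :: complex set)"
    by (rule homeomorphic_affine_sets) (auto simp: affine_hyperplane)
  finally have "(?S - {s p}) homeomorphic (UNIV :: complex set)" .
  then obtain t where "homeomorphic_map (top_of_set (?S - {s p})) (euclidean :: complex topology) t"
    by (metis homeomorphic_space_top_of_set homeomorphic_space subtopology_UNIV)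
  moreover have "subtopology (top_of_set ?S) (?S - {s p}) = top_of_set (?S - {s p})"
    by (simp add: subtopology_subtopology Int_absorb1)
  ultimately have "homeomorphic_map (subtopology X (topspace X - {p})) euclidean (t \<circ> s)"
    using 1 homeomorphic_map_compose by metis
  then show ?thesis using that by blast
qed

lemma infinite_sphere: "infinite (topspace X)"
proof
  assume fin: "finite (topspace X)"
  have "topspace X \<noteq> {}"
    using homeomorphic_empty_space[OF homeomorphic_sphere]
    by (metis topspace_euclidean_subtopology null_topspace_iff_trivial sphere_eq_empty less_numeral_extra(1) not_less_iff_gr_or_eq)
  then obtain p where "p \<in> topspace X" by blast
  then obtain h where "homeomorphic_map (subtopology X (topspace X - {p})) (euclidean :: complex topology) h"
    by (rule puncture_homeomorphic_plane)
  from homeomorphic_imp_surjective_map[OF this] have "finite (UNIV :: complex set)"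
    using fin by (metis finite_imageI finite_Diff topspace_euclidean topspace_subtopology_subset Diff_subset)
  then show False by (simp add: infinite_UNIV_char_0)
qed

text \<open>If \<open>U\<close> misses a point \<open>q\<close>, puncturing at \<open>q\<close>
  turns \<open>U\<close> into a connected open set of the plane, where deleting a point is harmless.
  If \<open>U\<close> is the whole sphere, deleting \<open>p\<close> leaves a plane.\<close>

lemma connectedin_delete:
  assumes "openin X U" "connectedin X U"
  shows "connectedin X (U - {p})"
proof (cases "p \<in> U")
  case True
  have sub: "U \<subseteq> topspace X" using assms openin_subset by blast
  show ?thesis
  proof (cases "U = topspace X")
    case True
    with \<open>p \<in> U\<close> obtain h where h: "homeomorphic_map (subtopology X (topspace X - {p})) (euclidean :: complex topology) h"
      using puncture_homeomorphic_plane by blast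
    have "connected_space (euclidean :: complex topology)"
      by (metis connected_UNIV connectedin_iff_connected connectedin_topspace topspace_euclidean)
    then have "connected_space (subtopology X (topspace X - {p}))"
      using h homeomorphic_connected_space homeomorphic_space by blast
    then show ?thesis using True by (auto simp: connectedin_def)
  next
    case False
    then obtain q where q: "q \<in> topspace X" "q \<notin> U" using sub by blast
    let ?Y = "subtopology X (topspace X - {q})"
    obtain h where h: "homeomorphic_map ?Y (euclidean :: complex topology) h"
      using puncture_homeomorphic_plane q by blast
    have UY: "U \<subseteq> topspace ?Y" using q sub by auto
    have 1: "open (h ` U)"
      using homeomorphic_map_openness[OF h UY] assms(1)
      by (metis UY openin_subtopology_Int2 inf.absorb_iff2 inf_commute open_openin openin_subset_topspace_eq openin_subtopology topspace_subtopology le_inf_iff)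
    have 2: "connected (h ` U)"
      using homeomorphic_map_connectedness[OF h UY] assms(2) UY
      by (metis connectedin_iff_connected connectedin_subtopology le_inf_iff topspace_subtopology)
    have "connected (h ` U - {h p})"
      using connected_open_delete[OF 1 2] by simp
    moreover have "h ` U - {h p} = h ` (U - {p})"
      using homeomorphic_imp_injective_map[OF h] UY True by (auto simp: inj_on_def)
    ultimately have "connectedin ?Y (U - {p})"
      using homeomorphic_map_connectedness[OF h, of "U - {p}"] UY by (auto simp: connectedin_iff_connected)
    then show ?thesis by (simp add: connectedin_subtopology)
  qed
qed (simp add: assms)

text \<open>Applied later to the critical values, off which the number of preimages is locally
  constant.\<close>

lemma connectedin_delete_finite:
  assumes "finite F"
  shows "connectedin X (topspace X - F)"
  using assms
proof (induction F)
  case empty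
  then show ?case using connected_space_sphere by (simp add: connectedin_topspace)
next
  case (insert p F)
  have "openin X (topspace X - F)"
  proof -
    have "closedin X (topspace X \<inter> F)"
      using closedin_Hausdorff_finite[OF Hausdorff_sphere] insert(1) by blast
    moreover have "topspace X - F = topspace X - topspace X \<inter> F" by blast
    ultimately show ?thesis by (simp add: openin_diff)
  qed
  from connectedin_delete[OF this insert.IH] show ?case
    by (metis Diff_insert)
qed

text \<open>Whether or not \<open>p \<in> F\<close>, its image in the plane is closed, so no case distinction on the
  position of the puncture is needed; a connecting set that runs through \<open>p\<close> is first made open and
  then punctured.\<close>

lemma component_separates:
  assumes F: "closedin X F" and a: "a \<in> topspace X" and c: "c \<in> topspace X"
    and sep: "\<not> connected_component_of (subtopology X (topspace X - F)) a c"
  obtains K where "K \<in> connected_components_of (subtopology X F)"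
    "\<not> connected_component_of (subtopology X (topspace X - K)) a c"
proof -
  have Fsub: "F \<subseteq> topspace X" using F closedin_subset by blast
  \<comment> \<open>The puncture must differ from \<open>a\<close> and \<open>c\<close> so that both
    have images in the plane; it may well lie in \<open>F\<close>.\<close>
  obtain p where p: "p \<in> topspace X" "p \<noteq> a" "p \<noteq> c"
    using infinite_sphere by (metis finite.emptyI finite.insertI finite_subset insertCI subsetI)
  let ?Y = "subtopology X (topspace X - {p})"
  obtain h where h: "homeomorphic_map ?Y (euclidean :: complex topology) h"
    using puncture_homeomorphic_plane p by blast
  obtain k where hk: "homeomorphic_maps ?Y (euclidean :: complex topology) h k"
    using h homeomorphic_map_maps by blast
  have kh: "k (h x) = x" if "x \<in> topspace X - {p}" for x
    using hk that by (auto simp: homeomorphic_maps_def)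
  have hk': "h (k z) = z" "k z \<in> topspace X - {p}" for z
    using hk by (auto simp: homeomorphic_maps_def continuous_map_def)
  have kcont: "connectedin ?Y (k ` T)" if "connected T" for T
    using hk that connectedin_continuous_map_image[of euclidean ?Y k T]
    by (auto simp: homeomorphic_maps_def connectedin_iff_connected)
  let ?F = "h ` (F - {p})"
  have "closedin ?Y (F - {p})"
    using F Fsub by (auto simp: closedin_subtopology)
  then have clF: "closed ?F"
    using homeomorphic_map_closedness[OF h, of "F - {p}"] Fsub by auto
  have "\<not> connected_component (- ?F) (h a) (h c)"
  proof
    assume "connected_component (- ?F) (h a) (h c)"
    then obtain T where T: "connected T" "T \<subseteq> - ?F" "h a \<in> T" "h c \<in> T"
      by (auto simp: connected_component_def)
    have "k ` T \<subseteq> topspace X - F"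
    proof
      fix y assume "y \<in> k ` T"
      then obtain z where "z \<in> T" "y = k z" by blast
      moreover have "h (k z) \<in> ?F" if "k z \<in> F" using that hk'(2) by blast
      ultimately show "y \<in> topspace X - F" using T(2) hk'[of z] by auto
    qed
    moreover have "connectedin X (k ` T)"
      using kcont[OF T(1)] by (simp add: connectedin_subtopology)
    moreover have "a \<in> k ` T" "c \<in> k ` T" using T p a c kh by force+
    ultimately show False using sep by (auto simp: connected_component_of_def connectedin_subtopology)
  qed
  \<comment> \<open>Planar separation theorem: two points separated by a closed set are already
    separated by one of its components.\<close>
  then obtain C where C: "C \<in> components ?F" and Csep: "\<not> connected_component (- C) (h a) (h c)"
    using separation_by_component_closed_pointwise[OF clF] by blast
  have "C \<noteq> {}" "C \<subseteq> ?F" "connected C"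
    using C in_components_nonempty in_components_subset in_components_connected by blast+
  have kC: "connectedin X (k ` C)" "k ` C \<subseteq> F"
    using kcont[OF \<open>connected C\<close>] \<open>C \<subseteq> ?F\<close> kh Fsub by (force simp: connectedin_subtopology)+
  then have kC': "connectedin (subtopology X F) (k ` C)" by (simp add: connectedin_subtopology)
  obtain z where "z \<in> C" using \<open>C \<noteq> {}\<close> by blast
  \<comment> \<open>If \<open>p\<close> lies in \<open>F\<close>, the preimage of \<open>C\<close>
    may be only a part of a component of \<open>F\<close>, so the full component containing it is
    taken.\<close>
  let ?K = "connected_component_of_set (subtopology X F) (k z)"
  have kK: "k ` C \<subseteq> ?K"
    using connected_component_of_maximal[OF kC'] \<open>z \<in> C\<close> by blast
  have Kcomp: "?K \<in> connected_components_of (subtopology X F)"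
    using \<open>z \<in> C\<close> kC Fsub by (auto simp: connected_components_of_def)
  have "\<not> connected_component_of (subtopology X (topspace X - ?K)) a c"
  proof
    assume con: "connected_component_of (subtopology X (topspace X - ?K)) a c"
    \<comment> \<open>The whole component of \<open>a\<close> off \<open>?K\<close> is open by local
      connectedness, so it survives the removal of \<open>p\<close>; its image would join
      \<open>h a\<close> to \<open>h c\<close> off \<open>C\<close>.\<close>
    let ?M = "connected_component_of_set (subtopology X (topspace X - ?K)) a"
    have "closedin (subtopology X F) ?K" by (rule closedin_connected_component_of)
    then have "closedin X ?K" using F closedin_trans_full by blast
    then have opn: "openin X (topspace X - ?K)" by blast
    then have "locally_connected_space (subtopology X (topspace X - ?K))"
      using locally_connected_sphere locally_connected_space_open_subset by blast
    then have "openin (subtopology X (topspace X - ?K)) ?M"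
      by (rule openin_connected_component_of_locally_connected_space)
    then have Mo: "openin X ?M" using opn openin_trans_full by blast
    have Mc: "connectedin X ?M" "?M \<subseteq> topspace X - ?K"
      using connectedin_connected_component_of[of "subtopology X (topspace X - ?K)" a]
      by (auto simp: connectedin_subtopology)
    have ac: "a \<in> ?M" "c \<in> ?M"
      using con connected_component_of_refl connected_component_in_topspace by fastforce+
    have "connectedin X (?M - {p})" using connectedin_delete[OF Mo Mc(1)] .
    then have "connectedin ?Y (?M - {p})"
      using Mc by (auto simp: connectedin_subtopology)
    then have "connected (h ` (?M - {p}))"
      using homeomorphic_map_connectedness[OF h, of "?M - {p}"] Mc by (auto simp: connectedin_iff_connected)
    moreover have "h ` (?M - {p}) \<subseteq> - C"
    proof clarsimp
      fix x assume x: "connected_component_of (subtopology X (topspace X - ?K)) a x" "x \<noteq> p" "h x \<in> C"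
      then have "x \<in> topspace X - ?K" using Mc by blast
      moreover from this have "x \<in> k ` C" using x kh by force
      ultimately show False using kK by blast
    qed
    moreover have "h a \<in> h ` (?M - {p})" "h c \<in> h ` (?M - {p})" using ac p by blast+
    ultimately show False using Csep unfolding connected_component_def by blast
  qed
  then show ?thesis using that Kcomp by blast
qed

end

section \<open>Counting tiles by distance\<close>

text \<open>Index \<open>i\<close> holds the last tiles of chains of \<open>i + 1\<close>
  successively meeting tiles, repetitions allowed, whose first tile meets \<open>E\<close>. The
  combinatorial distance to \<open>E\<close> is therefore the least such index plus one.\<close>

primrec tile_ball :: "'a set set \<Rightarrow> 'a set \<Rightarrow> nat \<Rightarrow> 'a set set" where
  "tile_ball \<T> E 0 = {T \<in> \<T>. T \<inter> E \<noteq> {}}"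
| "tile_ball \<T> E (Suc i) = {T \<in> \<T>. T \<inter> \<Union>(tile_ball \<T> E i) \<noteq> {}}"

lemma tile_ball_subset: "tile_ball \<T> E i \<subseteq> \<T>"
  by (cases i) auto

text \<open>A nonempty tile meets itself, so a chain can be prolonged by repeating its last
  tile.\<close>

lemma tile_ball_Suc_mono:
  assumes "{} \<notin> \<T>"
  shows "tile_ball \<T> E i \<subseteq> tile_ball \<T> E (Suc i)"
proof
  fix T assume T: "T \<in> tile_ball \<T> E i"
  then have "T \<in> \<T>" using tile_ball_subset by blast
  moreover from this have "T \<noteq> {}" using assms by blast
  ultimately show "T \<in> tile_ball \<T> E (Suc i)" using T by auto
qed

text \<open>Going back through the levels one tile at a time leads from \<open>T\<close> to
  \<open>E\<close>. Such a chain later ties a separating component to \<open>E\<close>.\<close>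

lemma tile_ball_chain:
  assumes "\<And>T. T \<in> \<T> \<Longrightarrow> connectedin X T" and "T \<in> tile_ball \<T> E i"
  obtains S where "S \<subseteq> \<T>" "finite S" "card S \<le> Suc i" "T \<in> S" "connectedin X (\<Union>S)" "\<Union>S \<inter> E \<noteq> {}"
  using assms(2)
proof (induction i arbitrary: T thesis)
  case 0
  show ?case by (rule 0(1)[of "{T}"]) (use 0(2) assms(1) in auto)
next
  case (Suc i)
  obtain T' where T': "T' \<in> tile_ball \<T> E i" "T \<inter> T' \<noteq> {}" and T: "T \<in> \<T>"
    using Suc.prems(2) by auto
  obtain S where S: "S \<subseteq> \<T>" "finite S" "card S \<le> Suc i" "T' \<in> S" "connectedin X (\<Union>S)" "\<Union>S \<inter> E \<noteq> {}"
    using Suc.IH[OF _ T'(1)] by blast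
  have "card (insert T S) \<le> Suc (Suc i)"
    using S by (simp add: card_insert_if)
  moreover have "connectedin X (\<Union>(insert T S))"
    using connectedin_Un[OF assms(1)[OF T] S(5)] T'(2) S(4) by auto
  ultimately show ?case using S T by (intro Suc.prems(1)[of "insert T S"]) auto
qed

context topological_sphere begin

text \<open>The level \<open>L\<close> separates the ball \<open>?P\<close>, which contains the
  tiles at \<open>E\<close>, from the remaining tiles \<open>R\<close>, which cover
  \<open>G\<close>. One component \<open>K\<close> of its union still separates and is itself a
  union of tiles; with a chain of at most \<open>i + 1\<close> tiles back to \<open>E\<close> it
  meets \<open>E\<close>, \<open>B\<close> and \<open>B'\<close>.\<close>

lemma tile_level_card:
  assumes fin: "finite \<T>"
    and cl: "\<And>T. T \<in> \<T> \<Longrightarrow> closedin X T" and con: "\<And>T. T \<in> \<T> \<Longrightarrow> connectedin X T"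
    and ne: "{} \<notin> \<T>" and cover: "\<Union>\<T> = topspace X"
    and "E \<noteq> {}" "G \<noteq> {}" and EBG: "connectedin X (E \<union> B \<union> G)" "connectedin X (E \<union> B' \<union> G)"
    and EG: "\<And>S. S \<subseteq> \<T> \<Longrightarrow> connectedin X (\<Union>S) \<Longrightarrow> \<Union>S \<inter> E \<noteq> {} \<Longrightarrow> \<Union>S \<inter> G \<noteq> {} \<Longrightarrow> N \<le> card S"
    and EBB: "\<And>S. S \<subseteq> \<T> \<Longrightarrow> connectedin X (\<Union>S) \<Longrightarrow> \<Union>S \<inter> E \<noteq> {} \<Longrightarrow> \<Union>S \<inter> B \<noteq> {}
      \<Longrightarrow> \<Union>S \<inter> B' \<noteq> {} \<Longrightarrow> N \<le> card S"
    and i: "i + 2 < N"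
  shows "N \<le> card (tile_ball \<T> E (Suc i) - tile_ball \<T> E i) + Suc i"
proof -
  define L where "L = tile_ball \<T> E (Suc i) - tile_ball \<T> E i"
  define R where "R = \<T> - tile_ball \<T> E (Suc i)"
  let ?P = "tile_ball \<T> E i"
  have PT: "?P \<subseteq> \<T>" by (rule tile_ball_subset)
  have LT: "L \<subseteq> \<T>" using tile_ball_subset unfolding L_def by blast
  have finL: "finite L" using LT fin finite_subset by blast
  have split: "\<T> = ?P \<union> L \<union> R"
    using tile_ball_subset[of \<T> E "Suc i"] tile_ball_Suc_mono[OF ne, of E i] unfolding L_def R_def by blast
  have clU: "closedin X (\<Union>S)" if "S \<subseteq> \<T>" for S
    using that cl fin by (intro closedin_Union) (auto intro: finite_subset)
  have E0: "tile_ball \<T> E 0 \<subseteq> ?P"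
  proof (induction i)
    case (Suc i) then show ?case using tile_ball_Suc_mono[OF ne, of E i] by blast
  qed simp
  \<comment> \<open>Otherwise a chain of at most \<open>Suc j\<close> tiles would join
    \<open>E\<close> to \<open>G\<close>, although \<open>Suc j \<le> i + 2\<close> and
    \<open>i + 2 < N\<close>.\<close>
  have farG: "T \<inter> G = {}" if "T \<in> tile_ball \<T> E j" "j \<le> Suc i" for T j
  proof (rule ccontr)
    assume "T \<inter> G \<noteq> {}"
    obtain S where "S \<subseteq> \<T>" "finite S" "card S \<le> Suc j" "T \<in> S" "connectedin X (\<Union>S)" "\<Union>S \<inter> E \<noteq> {}"
      using tile_ball_chain[OF con \<open>T \<in> tile_ball \<T> E j\<close>] by metis
    then have "N \<le> card S" using EG[of S] \<open>T \<inter> G \<noteq> {}\<close> by blast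
    then show False using \<open>card S \<le> Suc j\<close> i \<open>j \<le> Suc i\<close> by linarith
  qed
  have LE: "\<Union>L \<inter> E = {}" using E0 LT unfolding L_def by fastforce
  have LG: "\<Union>L \<inter> G = {}" using farG[of _ "Suc i"] unfolding L_def by blast
  have PG: "\<Union>?P \<inter> G = {}" using farG[of _ i] by fastforce
  \<comment> \<open>A tile that touches the ball in even one point belongs to the next ball, so the
    two closed unions have no common boundary point.\<close>
  have PR: "\<Union>?P \<inter> \<Union>R = {}" unfolding R_def by auto
  obtain a c where ac: "a \<in> E" "c \<in> G" using \<open>E \<noteq> {}\<close> \<open>G \<noteq> {}\<close> by blast
  have tops: "a \<in> topspace X" "c \<in> topspace X" using ac EBG(1) connectedin_subset_topspace by blast+
  have aP: "a \<in> \<Union>?P"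
  proof -
    obtain T where "T \<in> \<T>" "a \<in> T" using cover tops by blast
    then have "T \<in> tile_ball \<T> E 0" using ac by auto
    then show ?thesis using E0 \<open>a \<in> T\<close> by blast
  qed
  have cR: "c \<in> \<Union>R" using cover tops split ac PG LG by blast
  \<comment> \<open>Off \<open>L\<close> the sphere is covered by the disjoint closed sets formed by
    \<open>?P\<close> and \<open>R\<close>, one containing \<open>a\<close> and the other
    \<open>c\<close>.\<close>
  have "\<not> connected_component_of (subtopology X (topspace X - \<Union>L)) a c"
  proof
    assume "connected_component_of (subtopology X (topspace X - \<Union>L)) a c"
    then obtain M where M: "connectedin X M" "M \<subseteq> topspace X - \<Union>L" "a \<in> M" "c \<in> M"
      by (auto simp: connected_component_of_def connectedin_subtopology)
    have "M \<subseteq> \<Union>?P \<union> \<Union>R" using M(2) cover split by blast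
    moreover have "closedin X (\<Union>?P)" "closedin X (\<Union>R)" using clU PT R_def by auto
    moreover have "\<Union>?P \<inter> \<Union>R \<inter> M = {}" "\<Union>?P \<inter> M \<noteq> {}" "\<Union>R \<inter> M \<noteq> {}"
      using M(3,4) PR aP cR by auto
    ultimately show False using M(1) unfolding connectedin_closedin by metis
  qed
  then obtain K where K: "K \<in> connected_components_of (subtopology X (\<Union>L))"
    and Ksep: "\<not> connected_component_of (subtopology X (topspace X - K)) a c"
    using component_separates[OF clU[OF LT] tops] by blast
  have KL: "K \<subseteq> \<Union>L"
    using connected_components_of_subset[OF K] by auto
  have Kcon: "connectedin X K"
    using connectedin_connected_components_of[OF K] by (simp add: connectedin_subtopology)
  \<comment> \<open>\<open>K\<close> avoids \<open>E\<close> and \<open>G\<close>. Were it to avoid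
    the connecting arc as well, \<open>a\<close> and \<open>c\<close> would be connected off
    \<open>K\<close>.\<close>
  have KB: "K \<inter> B \<noteq> {}" if "connectedin X (E \<union> B \<union> G)" for B
  proof
    assume "K \<inter> B = {}"
    then have "E \<union> B \<union> G \<subseteq> topspace X - K"
      using KL LE LG connectedin_subset_topspace[OF that] by blast
    then have "connectedin (subtopology X (topspace X - K)) (E \<union> B \<union> G)"
      using that by (simp add: connectedin_subtopology)
    then show False using Ksep ac unfolding connected_component_of_def by blast
  qed
  define S where "S = {T \<in> L. T \<subseteq> K}"
  \<comment> \<open>Tiles are connected, so each tile of \<open>L\<close> lies in a single component
    of the union of \<open>L\<close>.\<close>
  have "T \<subseteq> K" if "T \<in> L" "T \<inter> K \<noteq> {}" for T
  proof -
    have "connectedin (subtopology X (\<Union>L)) T"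
      using con that LT by (auto simp: connectedin_subtopology)
    then show ?thesis
      using connected_components_of_maximal[OF K] that by (auto simp: disjnt_def)
  qed
  then have SK: "\<Union>S = K" using KL unfolding S_def by blast
  have "K \<noteq> {}" using KB[OF EBG(1)] by blast
  then obtain T where T: "T \<in> S" "T \<noteq> {}" using SK by blast
  \<comment> \<open>A tile of the level touches a tile of index \<open>i\<close>, and the chain from
    there to \<open>E\<close> costs at most \<open>i + 1\<close> tiles.\<close>
  then have "T \<in> tile_ball \<T> E (Suc i)" unfolding S_def L_def by blast
  then obtain T' where T': "T' \<in> ?P" "T \<inter> T' \<noteq> {}" by auto
  obtain S' where S': "S' \<subseteq> \<T>" "finite S'" "card S' \<le> Suc i" "T' \<in> S'" "connectedin X (\<Union>S')" "\<Union>S' \<inter> E \<noteq> {}"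
    using tile_ball_chain[OF con T'(1)] by metis
  have "connectedin X (\<Union>(S \<union> S'))"
    using connectedin_Un[OF Kcon S'(5)] SK T T' S'(4) by (simp add: Union_Un_distrib) blast
  moreover have "S \<union> S' \<subseteq> \<T>" using S' LT S_def by blast
  ultimately have N: "N \<le> card (S \<union> S')"
    using EBB[of "S \<union> S'"] S'(6) KB[OF EBG(1)] KB[OF EBG(2)] SK by blast
  have "card S \<le> card L" using finL by (auto simp: S_def intro: card_mono)
  then show ?thesis using N card_Un_le[of S S'] S'(3) unfolding L_def by linarith
qed

text \<open>The levels contribute at least \<open>N - j\<close> tiles for \<open>j\<close> from
  \<open>1\<close> to \<open>N - 2\<close>. Twice this sum is
  \<open>(N - 2) * (N + 1) = N * (N - 1) - 2\<close>, which explains the summand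
  \<open>2\<close>.\<close>

lemma tile_count_lower_bound:
  assumes fin: "finite \<T>"
    and cl: "\<And>T. T \<in> \<T> \<Longrightarrow> closedin X T" and con: "\<And>T. T \<in> \<T> \<Longrightarrow> connectedin X T"
    and ne: "{} \<notin> \<T>" and cover: "\<Union>\<T> = topspace X"
    and EG_ne: "E \<noteq> {}" "G \<noteq> {}"
    and EBG: "connectedin X (E \<union> B \<union> G)" "connectedin X (E \<union> B' \<union> G)"
    and EG: "\<And>S. S \<subseteq> \<T> \<Longrightarrow> connectedin X (\<Union>S) \<Longrightarrow> \<Union>S \<inter> E \<noteq> {} \<Longrightarrow> \<Union>S \<inter> G \<noteq> {} \<Longrightarrow> N \<le> card S"
    and EBB: "\<And>S. S \<subseteq> \<T> \<Longrightarrow> connectedin X (\<Union>S) \<Longrightarrow> \<Union>S \<inter> E \<noteq> {} \<Longrightarrow> \<Union>S \<inter> B \<noteq> {}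
      \<Longrightarrow> \<Union>S \<inter> B' \<noteq> {} \<Longrightarrow> N \<le> card S"
  shows "N * (N - 1) \<le> 2 * card \<T> + 2"
proof (cases "N < 2")
  case True
  then show ?thesis by (cases N) auto
next
  case False
  then obtain m where m: "N = m + 2" by (metis add.commute le_Suc_ex not_less)
  \<comment> \<open>This is the partial sum of the level bounds, doubled and rearranged so that no
    subtraction of variable terms occurs; the ball of index \<open>0\<close> is bounded below by
    zero only.\<close>
  have "2 * i * (N - 1) + i \<le> 2 * card (tile_ball \<T> E i) + i * i" if "i \<le> m" for i
    using that
  proof (induction i)
    case (Suc i)
    have "card (tile_ball \<T> E (Suc i)) = card (tile_ball \<T> E i) + card (tile_ball \<T> E (Suc i) - tile_ball \<T> E i)"
      using tile_ball_Suc_mono[OF ne, of E i] fin tile_ball_subset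
      by (metis card_Diff_subset card_mono finite_subset le_add_diff_inverse)
    moreover have "N \<le> card (tile_ball \<T> E (Suc i) - tile_ball \<T> E i) + Suc i"
      by (rule tile_level_card[OF fin cl con ne cover EG_ne EBG EG EBB]) (use Suc.prems m in auto)
    ultimately show ?case using Suc.IH Suc.prems m by (simp add: algebra_simps)
  qed simp
  from this[of m] have "m * m + 3 * m \<le> 2 * card (tile_ball \<T> E m)"
    by (simp add: m algebra_simps)
  also have "card (tile_ball \<T> E m) \<le> card \<T>"
    using fin tile_ball_subset by (metis card_mono)
  finally show ?thesis by (simp add: m algebra_simps)
qed

end

section \<open>Fibres of branched coverings\<close>

lemma planar_chart_inj:
  assumes "planar_chart X (U, \<phi>)"
  shows "inj_on \<phi> U"
proof -
  have U: "openin X U" "homeomorphic_map (subtopology X U) (top_of_set (\<phi> ` U)) \<phi>"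
    using assms by (auto simp: planar_chart_def)
  then show ?thesis
    using homeomorphic_imp_injective_map[OF U(2)] openin_subset[OF U(1)] by (metis topspace_subtopology_subset)
qed

lemma planar_chart_open_image:
  assumes c: "planar_chart X (U, \<phi>)" and W: "openin X W" "W \<subseteq> U"
  shows "open (\<phi> ` W)"
proof -
  have U: "openin X U" "open (\<phi> ` U)" "homeomorphic_map (subtopology X U) (top_of_set (\<phi> ` U)) \<phi>"
    using c by (auto simp: planar_chart_def)
  have "openin (subtopology X U) W"
    using W U(1) by (simp add: openin_open_subtopology)
  then have "openin (top_of_set (\<phi> ` U)) (\<phi> ` W)"
    using homeomorphic_imp_open_map[OF U(3)] by (simp add: open_map_def)
  then show ?thesis using U(2) openin_open_trans by blast
qed

lemma planar_chart_open_vimage: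
  assumes c: "planar_chart X (U, \<phi>)" and Z: "open Z"
  shows "openin X {x \<in> U. \<phi> x \<in> Z}"
proof -
  have U: "openin X U" "homeomorphic_map (subtopology X U) (top_of_set (\<phi> ` U)) \<phi>"
    using c by (auto simp: planar_chart_def)
  have "continuous_map (subtopology X U) euclidean \<phi>"
    using homeomorphic_imp_continuous_map[OF U(2)] by (simp add: continuous_map_in_subtopology)
  then have "openin (subtopology X U) {x \<in> topspace (subtopology X U). \<phi> x \<in> Z}"
    using Z by (intro openin_continuous_map_preimage) auto
  then have "openin (subtopology X U) {x \<in> U. \<phi> x \<in> Z}"
    using openin_subset[OF U(1)] by (metis topspace_subtopology_subset)
  then show ?thesis using U(1) openin_open_subtopology by blast
qed

lemma local_power_formE:
  assumes "local_power_form X A f p d"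
  obtains U \<phi> V \<psi> where "d \<ge> 1" "planar_chart X (U, \<phi>)" "planar_chart X (V, \<psi>)" "p \<in> U" "\<phi> p = 0"
    "f p \<in> V" "\<psi> (f p) = 0" "f ` U \<subseteq> V" "\<forall>x\<in>U. \<psi> (f x) = \<phi> x ^ d" "openin X U"
proof -
  obtain U \<phi> V \<psi> where "positive_chart X A (U, \<phi>)" "positive_chart X A (V, \<psi>)"
    and c: "d \<ge> 1" "p \<in> U" "\<phi> p = 0" "f p \<in> V" "\<psi> (f p) = 0" "f ` U \<subseteq> V" "\<forall>x\<in>U. \<psi> (f x) = \<phi> x ^ d"
    using assms unfolding local_power_form_def by metis
  then have p: "planar_chart X (U, \<phi>)" "planar_chart X (V, \<psi>)" by (simp_all add: positive_chart_def)
  then have "openin X U" by (simp add: planar_chart_def)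
  then show ?thesis using that[OF c(1) p c(2-7)] by blast
qed

lemma complex_root_exists:
  assumes "n \<ge> 1"
  obtains z :: complex where "z ^ n = w"
proof (cases "w = 0")
  case True then show ?thesis using assms that[of 0] by (simp add: power_0_left)
next
  case False
  then have "card {z. z ^ n = w} = n" using assms by (intro card_nth_roots) auto
  then have "{z. z ^ n = w} \<noteq> {}" using assms by force
  then show ?thesis using that by blast
qed

text \<open>The power map sends the disk of radius \<open>r\<close> onto the disk of radius
  \<open>r ^ d\<close>, since every complex number has a root; pulled back through the charts, this
  makes \<open>f\<close> open at \<open>p\<close>.\<close>

lemma local_power_form_open:
  assumes "local_power_form X A f p d" and W: "openin X W" "p \<in> W"
  shows "\<exists>N. openin X N \<and> f p \<in> N \<and> N \<subseteq> f ` W"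
proof -
  obtain U \<phi> V \<psi> where c: "d \<ge> 1" "planar_chart X (U, \<phi>)" "planar_chart X (V, \<psi>)" "p \<in> U" "\<phi> p = 0"
    "f p \<in> V" "\<psi> (f p) = 0" "f ` U \<subseteq> V" and pw: "\<forall>x\<in>U. \<psi> (f x) = \<phi> x ^ d"
    and "openin X U"
    using assms(1) by (rule local_power_formE)
  have "open (\<phi> ` (W \<inter> U))"
    using c W \<open>openin X U\<close> by (intro planar_chart_open_image) auto
  moreover have "0 \<in> \<phi> ` (W \<inter> U)" using c W by force
  ultimately obtain r where r: "r > 0" "ball 0 r \<subseteq> \<phi> ` (W \<inter> U)"
    using openE by blast
  let ?N = "{y \<in> V. \<psi> y \<in> ball 0 (r ^ d)}"
  have "openin X ?N" using c by (intro planar_chart_open_vimage) auto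
  moreover have "f p \<in> ?N" using c r by auto
  moreover have "?N \<subseteq> f ` W"
  proof
    fix y assume y: "y \<in> ?N"
    obtain z where z: "z ^ d = \<psi> y" using complex_root_exists[OF c(1)] by blast
    have "norm z ^ d < r ^ d" using y z by (simp flip: norm_power)
    then have "norm z < r" using r power_less_imp_less_base by force
    then obtain x where x: "x \<in> W" "x \<in> U" "\<phi> x = z" using r by force
    have "\<psi> (f x) = \<psi> y" using pw x z by simp
    then have "f x = y"
      by (rule inj_onD[OF planar_chart_inj[OF c(3)]]) (use c(8) x y in auto)
    then show "y \<in> f ` W" using x by blast
  qed
  ultimately show ?thesis by blast
qed

text \<open>In the second pair of charts some value near \<open>f p\<close> has \<open>d'\<close>
  preimages near \<open>p\<close>. The first pair sends these injectively to \<open>d\<close>-th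
  roots of one nonzero number, of which there are \<open>d\<close>.\<close>

lemma local_power_form_degree_le:
  assumes "local_power_form X A f p d" and "local_power_form X A f p d'"
  shows "d' \<le> d"
proof -
  obtain U \<phi> V \<psi> where c: "d \<ge> 1" "planar_chart X (U, \<phi>)" "planar_chart X (V, \<psi>)" "p \<in> U" "\<phi> p = 0"
    "f p \<in> V" "\<psi> (f p) = 0" "f ` U \<subseteq> V" and pw: "\<forall>x\<in>U. \<psi> (f x) = \<phi> x ^ d"
    and U: "openin X U"
    using assms(1) by (rule local_power_formE)
  obtain U' \<phi>' V' \<psi>' where c': "d' \<ge> 1" "planar_chart X (U', \<phi>')" "planar_chart X (V', \<psi>')" "p \<in> U'" "\<phi>' p = 0"
    "f p \<in> V'" "\<psi>' (f p) = 0" "f ` U' \<subseteq> V'" and pw': "\<forall>x\<in>U'. \<psi>' (f x) = \<phi>' x ^ d'"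
    and U': "openin X U'"
    using assms(2) by (rule local_power_formE)
  have "open (\<phi>' ` (U \<inter> U'))"
    using c' U U' by (intro planar_chart_open_image[OF c'(2)]) auto
  moreover have "0 \<in> \<phi>' ` (U \<inter> U')" using c c' by force
  ultimately obtain r where r: "r > 0" "ball 0 r \<subseteq> \<phi>' ` (U \<inter> U')"
    using openE by blast
  \<comment> \<open>Any nonzero point of the disk would do; all numbers with the same
    \<open>d'\<close>-th power have its modulus and so lie in the disk too.\<close>
  define z where "z = complex_of_real (r / 2)"
  have z: "z \<noteq> 0" "norm z < r" using r by (auto simp: z_def)
  define R where "R = {w. w ^ d' = z ^ d'}"
  have cR: "card R = d'" unfolding R_def using z c' by (intro card_nth_roots) auto
  have "\<exists>x. x \<in> U \<inter> U' \<and> \<phi>' x = w" if "w \<in> R" for w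
  proof -
    have "norm w ^ d' = norm z ^ d'" using that by (metis (mono_tags) R_def mem_Collect_eq norm_power)
    then have "norm w = norm z" using c' power_eq_imp_eq_base[of "norm w" d' "norm z"] by simp
    then have "w \<in> ball 0 r" using z by simp
    then show ?thesis using r by blast
  qed
  then obtain g where g: "\<And>w. w \<in> R \<Longrightarrow> g w \<in> U \<inter> U' \<and> \<phi>' (g w) = w" by metis
  have "z \<in> R" by (simp add: R_def)
  have same: "f (g w) = f (g z)" if "w \<in> R" for w
  proof (rule inj_onD[OF planar_chart_inj[OF c'(3)]])
    show "\<psi>' (f (g w)) = \<psi>' (f (g z))"
      using pw' g[OF that] g[OF \<open>z \<in> R\<close>] that by (simp add: R_def)
  qed (use g that \<open>z \<in> R\<close> c' in auto)
  let ?Q = "{u. u ^ d = \<psi> (f (g z))}"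
  \<comment> \<open>Only a nonzero number has exactly \<open>d\<close> roots, so the lifted point
    must be kept away from \<open>p\<close>.\<close>
  have "g z \<noteq> p" using g[OF \<open>z \<in> R\<close>] c'(5) z by auto
  then have "\<phi> (g z) \<noteq> 0"
    using inj_onD[OF planar_chart_inj[OF c(2)], of "g z" p] g[OF \<open>z \<in> R\<close>] c(4,5) by fastforce
  then have "\<psi> (f (g z)) \<noteq> 0" using pw g[OF \<open>z \<in> R\<close>] by simp
  then have cQ: "card ?Q = d" using c by (intro card_nth_roots) auto
  have "inj_on (\<lambda>w. \<phi> (g w)) R"
  proof (rule inj_onI)
    fix v w assume "v \<in> R" "w \<in> R" "\<phi> (g v) = \<phi> (g w)"
    then have "g v = g w" using inj_onD[OF planar_chart_inj[OF c(2)]] g by blast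
    then show "v = w" using g \<open>v \<in> R\<close> \<open>w \<in> R\<close> by metis
  qed
  moreover have "(\<lambda>w. \<phi> (g w)) ` R \<subseteq> ?Q"
    using same g pw by force
  moreover have "finite ?Q" using c by (intro finite_nth_roots) auto
  ultimately have "card R \<le> card ?Q" by (intro card_inj_on_le)
  then show ?thesis using cR cQ by simp
qed

lemma local_power_form_finite_fibre:
  assumes "local_power_form X A f p d"
  shows "\<exists>U. openin X U \<and> p \<in> U \<and> (\<forall>q. finite {x \<in> U. f x = q})"
proof -
  obtain U \<phi> V \<psi> where c: "d \<ge> 1" "planar_chart X (U, \<phi>)" "planar_chart X (V, \<psi>)" "p \<in> U" "\<phi> p = 0"
    "f p \<in> V" "\<psi> (f p) = 0" "f ` U \<subseteq> V" and pw: "\<forall>x\<in>U. \<psi> (f x) = \<phi> x ^ d" and U: "openin X U"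
    using assms(1) by (rule local_power_formE)
  have "finite {x \<in> U. f x = q}" for q
  proof (rule inj_on_finite)
    show "inj_on \<phi> {x \<in> U. f x = q}"
      using planar_chart_inj[OF c(2)] by (rule inj_on_subset) auto
    show "\<phi> ` {x \<in> U. f x = q} \<subseteq> {u. u ^ d = \<psi> q}" using pw by auto
    show "finite {u. u ^ d = \<psi> q}" using c by (intro finite_nth_roots) auto
  qed
  then show ?thesis using U c by blast
qed

text \<open>Applying the degree comparison both ways shows that the exponent is unique, so the
  definite description in \<open>local_degree\<close> denotes it.\<close>

lemma local_power_form_local_degree:
  assumes "branched_covering_map X A f" "p \<in> topspace X"
  shows "local_power_form X A f p (local_degree X A f p)"
proof -
  obtain d where d: "local_power_form X A f p d"
    using assms unfolding branched_covering_map_def by blast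
  show ?thesis unfolding local_degree_def
  proof (rule theI[where a = d])
    show "e = d" if "local_power_form X A f p e" for e
      using local_power_form_degree_le[OF d that] local_power_form_degree_le[OF that d] by simp
  qed (rule d)
qed

text \<open>At local degree one the map reads as the identity in the charts.\<close>

lemma noncritical_locally_injective:
  assumes "branched_covering_map X A f" "p \<in> topspace X" "p \<notin> critical_points X A f"
  shows "\<exists>U. openin X U \<and> p \<in> U \<and> inj_on f U"
proof -
  obtain U \<phi> V \<psi> where c: "local_degree X A f p \<ge> 1" "planar_chart X (U, \<phi>)" "planar_chart X (V, \<psi>)"
    "p \<in> U" "\<phi> p = 0" "f p \<in> V" "\<psi> (f p) = 0" "f ` U \<subseteq> V"
    and pw: "\<forall>x\<in>U. \<psi> (f x) = \<phi> x ^ local_degree X A f p" and U: "openin X U"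
    using local_power_form_local_degree[OF assms(1,2)] by (rule local_power_formE)
  have "local_degree X A f p = 1"
    using assms c by (auto simp: critical_points_def)
  then have "inj_on f U"
    using pw inj_onD[OF planar_chart_inj[OF c(2)]] by (intro inj_onI) (metis power_one_right)
  then show ?thesis using U c by blast
qed

lemma branched_covering_open_map:
  assumes "branched_covering_map X A f"
  shows "open_map X X f"
  unfolding open_map_def
proof (intro allI impI)
  fix W assume W: "openin X W"
  have "\<exists>N. openin X N \<and> y \<in> N \<and> N \<subseteq> f ` W" if y: "y \<in> f ` W" for y
  proof -
    obtain p where p: "p \<in> W" "y = f p" using y by blast
    then have "p \<in> topspace X" using W openin_subset by blast
    from local_power_form_open[OF local_power_form_local_degree[OF assms this] W p(1)] p
    show ?thesis by blast
  qed
  then show "openin X (f ` W)" by (subst openin_subopen) blast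
qed

lemma Hausdorff_finite_disjoint_nbhds:
  assumes "Hausdorff_space X" "finite F" "F \<subseteq> topspace X"
  obtains W where "\<And>x. x \<in> F \<Longrightarrow> openin X (W x) \<and> x \<in> W x"
    "\<And>x y. x \<in> F \<Longrightarrow> y \<in> F \<Longrightarrow> x \<noteq> y \<Longrightarrow> W x \<inter> W y = {}"
proof -
  have "\<forall>x y. \<exists>U V. x \<in> F \<and> y \<in> F \<and> x \<noteq> y \<longrightarrow> openin X U \<and> openin X V \<and> x \<in> U \<and> y \<in> V \<and> disjnt U V"
    using assms unfolding Hausdorff_space_def by (meson subsetD)
  then obtain U V where UV: "\<And>x y. x \<in> F \<Longrightarrow> y \<in> F \<Longrightarrow> x \<noteq> y \<Longrightarrow>
      openin X (U x y) \<and> openin X (V x y) \<and> x \<in> U x y \<and> y \<in> V x y \<and> disjnt (U x y) (V x y)"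
    by metis
  \<comment> \<open>The separating pairs need not be symmetric, so \<open>x\<close> is taken in both
    roles. Intersecting with \<open>topspace X\<close> covers the case of a single point, where the
    indexed intersection is over the empty set.\<close>
  define W where "W x = (\<Inter>y\<in>F - {x}. U x y \<inter> V y x) \<inter> topspace X" for x
  have 1: "openin X (W x) \<and> x \<in> W x" if "x \<in> F" for x
  proof
    show "openin X (W x)" unfolding W_def
      using assms UV that by (intro openin_INT) auto
    show "x \<in> W x" using UV that assms by (auto simp: W_def)
  qed
  have 2: "W x \<inter> W y = {}" if "x \<in> F" "y \<in> F" "x \<noteq> y" for x y
  proof -
    have "W x \<subseteq> U x y" "W y \<subseteq> V x y" using that by (auto simp: W_def)
    then show ?thesis using UV[OF that] by (auto simp: disjnt_def)
  qed
  show ?thesis using that[of W] 1 2 by blast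
qed

section \<open>Cardinality of fibres\<close>

abbreviation fibre :: "'a topology \<Rightarrow> ('a \<Rightarrow> 'a) \<Rightarrow> 'a \<Rightarrow> 'a set" where
  "fibre X f q \<equiv> {x \<in> topspace X. f x = q}"

text \<open>Each point has a neighbourhood containing finitely many preimages of \<open>q\<close>,
  and compactness reduces these neighbourhoods to finitely many.\<close>

lemma finite_fibre:
  assumes "compact_space X" "branched_covering_map X A f"
  shows "finite (fibre X f q)"
proof -
  have "\<forall>p\<in>topspace X. \<exists>U. openin X U \<and> p \<in> U \<and> finite {x \<in> U. f x = q}"
    using local_power_form_finite_fibre[OF local_power_form_local_degree[OF assms(2)]] by meson
  then obtain U where U: "\<And>p. p \<in> topspace X \<Longrightarrow> openin X (U p) \<and> p \<in> U p \<and> finite {x \<in> U p. f x = q}"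
    by metis
  have "\<forall>V\<in>U ` topspace X. openin X V" "topspace X \<subseteq> \<Union>(U ` topspace X)" using U by blast+
  then have "\<exists>\<F>. finite \<F> \<and> \<F> \<subseteq> U ` topspace X \<and> topspace X \<subseteq> \<Union>\<F>"
    using assms(1) unfolding compact_space_def compactin_def by presburger
  then obtain \<F> where F: "finite \<F>" "\<F> \<subseteq> U ` topspace X" "topspace X \<subseteq> \<Union>\<F>" by blast
  have "fibre X f q \<subseteq> (\<Union>V\<in>\<F>. {x \<in> V. f x = q})" using F(3) by blast
  moreover have "finite (\<Union>V\<in>\<F>. {x \<in> V. f x = q})" using F(1,2) U by blast
  ultimately show ?thesis by (rule finite_subset)
qed

text \<open>The points over \<open>q\<close> have disjoint open neighbourhoods on which
  \<open>f\<close> is injective. A value close to \<open>q\<close> has exactly one preimage in each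
  of these sheets and none elsewhere.\<close>

lemma card_fibre_locally_constant:
  assumes X: "compact_space X" "Hausdorff_space X" and f: "branched_covering_map X A f"
    and q: "q \<in> topspace X - f ` critical_points X A f"
  shows "\<exists>N. openin X N \<and> q \<in> N \<and> (\<forall>q'\<in>N. card (fibre X f q') = card (fibre X f q))"
proof -
  let ?F = "fibre X f q"
  have finF: "finite ?F" using finite_fibre[OF X(1) f] .
  obtain W where W: "\<And>x. x \<in> ?F \<Longrightarrow> openin X (W x) \<and> x \<in> W x"
    "\<And>x y. x \<in> ?F \<Longrightarrow> y \<in> ?F \<Longrightarrow> x \<noteq> y \<Longrightarrow> W x \<inter> W y = {}"
    using Hausdorff_finite_disjoint_nbhds[OF X(2) finF] by auto
  have "\<exists>U. openin X U \<and> x \<in> U \<and> inj_on f U" if "x \<in> ?F" for x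
    using that q by (intro noncritical_locally_injective[OF f]) auto
  then obtain U where U: "\<And>x. x \<in> ?F \<Longrightarrow> openin X (U x) \<and> x \<in> U x \<and> inj_on f (U x)" by metis
  define V where "V x = W x \<inter> U x" for x
  have V: "openin X (V x)" "x \<in> V x" "inj_on f (V x)" if "x \<in> ?F" for x
    using W(1)[OF that] U[OF that] by (auto simp: V_def intro: inj_on_subset)
  have Vdisj: "x = y" if "x \<in> ?F" "y \<in> ?F" "z \<in> V x" "z \<in> V y" for x y z
    using W(2)[OF that(1,2)] that by (auto simp: V_def)
  have op: "open_map X X f" using branched_covering_open_map[OF f] .
  have cont: "continuous_map X X f" using f by (simp add: branched_covering_map_def)
  then have cm: "closed_map X X f" using X continuous_imp_closed_map by blast
  have fX: "f x \<in> topspace X" if "x \<in> topspace X" for x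
    using cont that continuous_map_image_subset_topspace by blast
  \<comment> \<open>The first factor excludes preimages outside the sheets and is open because
    \<open>f\<close> is a closed map; the second provides a preimage in every sheet and is open
    because \<open>f\<close> is an open map.\<close>
  define N where "N = (topspace X - f ` (topspace X - (\<Union>x\<in>?F. V x))) \<inter> ((\<Inter>x\<in>?F. f ` V x) \<inter> topspace X)"
  have "openin X (\<Union>x\<in>?F. V x)" using V(1) by blast
  then have N1: "closedin X (f ` (topspace X - (\<Union>x\<in>?F. V x)))"
    using cm by (simp add: closed_map_def closedin_diff)
  have N2: "openin X ((\<Inter>x\<in>?F. f ` V x) \<inter> topspace X)"
    using finF V(1) op by (intro openin_INT) (auto simp: open_map_def)
  have "openin X N" unfolding N_def by (rule openin_Int[OF openin_diff[OF openin_topspace N1] N2])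
  moreover have "q \<in> N" unfolding N_def using q V(2) by auto
  moreover have "card (fibre X f q') = card ?F" if q': "q' \<in> N" for q'
  proof -
    have "\<forall>x\<in>?F. \<exists>y. y \<in> V x \<and> f y = q'" using q' unfolding N_def by blast
    then obtain g where g: "\<And>x. x \<in> ?F \<Longrightarrow> g x \<in> V x \<and> f (g x) = q'" by metis
    have "bij_betw g ?F (fibre X f q')"
      unfolding bij_betw_def
    proof
      show "inj_on g ?F"
      proof (rule inj_onI)
        fix x y assume xy: "x \<in> ?F" "y \<in> ?F" "g x = g y"
        have "g x \<in> V x" "g x \<in> V y" using g[OF xy(1)] g[OF xy(2)] xy(3) by simp_all
        then show "x = y" by (rule Vdisj[OF xy(1,2)])
      qed
      show "g ` ?F = fibre X f q'"
      proof
        show "g ` ?F \<subseteq> fibre X f q'"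
        proof
          fix y assume "y \<in> g ` ?F"
          then obtain x where x: "x \<in> ?F" "y = g x" by (rule imageE)
          then show "y \<in> fibre X f q'" using g[OF x(1)] openin_subset[OF V(1)[OF x(1)]] by auto
        qed
        show "fibre X f q' \<subseteq> g ` ?F"
        proof
          fix y assume y: "y \<in> fibre X f q'"
          have "y \<in> (\<Union>x\<in>?F. V x)" using y q' unfolding N_def by blast
          then obtain x where x: "x \<in> ?F" "y \<in> V x" by blast
          have "f y = f (g x)" using g[OF x(1)] y by simp
          then have "y = g x" using inj_onD[OF V(3)[OF x(1)]] g[OF x(1)] x(2) by blast
          then show "y \<in> g ` ?F" using x by blast
        qed
      qed
    qed
    then show ?thesis by (simp add: bij_betw_same_card)
  qed
  ultimately show ?thesis by blast
qed

text \<open>The critical values form a finite subset of the postcritical set, so their complement is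
  connected and the locally constant fibre cardinality is constant there. This also justifies the
  definite description in \<open>map_degree\<close>.\<close>

lemma (in topological_sphere) card_fibre_eq_map_degree:
  assumes f: "Thurston_map X A f" and q: "q \<in> topspace X - f ` critical_points X A f"
  shows "card (fibre X f q) = map_degree X A f"
proof -
  have bf: "branched_covering_map X A f" and "finite (post X A f)"
    using f by (auto simp: Thurston_map_def)
  moreover have "f ` critical_points X A f \<subseteq> post X A f"
    unfolding post_def by (rule UN_upper[of 1, THEN order_trans[rotated]]) auto
  ultimately have "finite (f ` critical_points X A f)" using finite_subset by blast
  let ?Y = "topspace X - f ` critical_points X A f"
  have con: "connectedin X ?Y" using connectedin_delete_finite \<open>finite (f ` critical_points X A f)\<close> by blast
  have "\<forall>q\<in>?Y. \<exists>N. openin X N \<and> q \<in> N \<and> (\<forall>q'\<in>N. card (fibre X f q') = card (fibre X f q))"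
    using card_fibre_locally_constant[OF compact_sphere Hausdorff_sphere bf] by blast
  from bchoice[OF this] obtain N
    where N: "\<forall>q\<in>?Y. openin X (N q) \<and> q \<in> N q \<and> (\<forall>q'\<in>N q. card (fibre X f q') = card (fibre X f q))"
    by blast
  have const: "card (fibre X f q') = card (fibre X f q)" if q': "q' \<in> ?Y" for q'
  proof (rule ccontr)
    assume ne: "card (fibre X f q') \<noteq> card (fibre X f q)"
    define E1 where "E1 = (\<Union>x\<in>{x \<in> ?Y. card (fibre X f x) = card (fibre X f q)}. N x)"
    define E2 where "E2 = (\<Union>x\<in>{x \<in> ?Y. card (fibre X f x) \<noteq> card (fibre X f q)}. N x)"
    have 1: "openin X E1" "openin X E2" unfolding E1_def E2_def using N by blast+
    have 2: "?Y \<subseteq> E1 \<union> E2" unfolding E1_def E2_def using N by blast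
    have 3: "q \<in> E1 \<inter> ?Y" "q' \<in> E2 \<inter> ?Y" unfolding E1_def E2_def using N q q' ne by blast+
    have "card (fibre X f z) = card (fibre X f q)" if "z \<in> E1" for z
    proof -
      from that obtain x where "x \<in> ?Y" "card (fibre X f x) = card (fibre X f q)" "z \<in> N x"
        unfolding E1_def by blast
      then show ?thesis using bspec[OF bspec[OF N \<open>x \<in> ?Y\<close>, THEN conjunct2, THEN conjunct2] \<open>z \<in> N x\<close>] by simp
    qed
    moreover have "card (fibre X f z) \<noteq> card (fibre X f q)" if "z \<in> E2" for z
    proof -
      from that obtain x where "x \<in> ?Y" "card (fibre X f x) \<noteq> card (fibre X f q)" "z \<in> N x"
        unfolding E2_def by blast
      then show ?thesis using bspec[OF bspec[OF N \<open>x \<in> ?Y\<close>, THEN conjunct2, THEN conjunct2] \<open>z \<in> N x\<close>] by simp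
    qed
    ultimately have 4: "E1 \<inter> E2 \<inter> ?Y = {}" by blast
    have 5: "E1 \<inter> ?Y \<noteq> {}" "E2 \<inter> ?Y \<noteq> {}" using 3 by blast+
    show False using con 1 2 4 5 unfolding connectedin by meson
  qed
  show ?thesis unfolding map_degree_def
  proof (rule the_equality[symmetric])
    show "\<forall>q'\<in>?Y. card (fibre X f q') = card (fibre X f q)" using const by blast
    show "d = card (fibre X f q)" if "\<forall>q\<in>?Y. card (fibre X f q) = d" for d
      using bspec[OF that q] by simp
  qed
qed

text \<open>Off the postcritical set, no iterated preimage of \<open>q\<close> is a critical value,
  so each backward step multiplies the number of points by at most the degree.\<close>

lemma (in topological_sphere) card_iterated_fibre:
  assumes f: "Thurston_map X A f" and q: "q \<in> topspace X - post X A f"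
  shows "finite (fibre X (f ^^ n) q) \<and> card (fibre X (f ^^ n) q) \<le> map_degree X A f ^ n"
proof (induction n)
  case 0
  have "fibre X (f ^^ 0) q = {q}" using q by auto
  then show ?case by simp
next
  case (Suc n)
  have bf: "branched_covering_map X A f" using f by (simp add: Thurston_map_def)
  then have fX: "f x \<in> topspace X" if "x \<in> topspace X" for x
    using that continuous_map_image_subset_topspace unfolding branched_covering_map_def by blast
  let ?F = "fibre X (f ^^ n) q"
  have eq: "fibre X (f ^^ Suc n) q = (\<Union>y\<in>?F. fibre X f y)"
    using fX by (auto simp: funpow_swap1)
  have "card (fibre X f y) = map_degree X A f" if y: "y \<in> ?F" for y
  proof (rule card_fibre_eq_map_degree[OF f])
    have "y \<notin> f ` critical_points X A f"
    proof
      assume "y \<in> f ` critical_points X A f"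
      then obtain c where "c \<in> critical_points X A f" "y = f c" by blast
      then have "q = (f ^^ Suc n) c" using y by (simp add: funpow_swap1)
      moreover have "(f ^^ Suc n) c \<in> post X A f"
        unfolding post_def by (rule UN_I[of "Suc n", OF _ imageI]) (use \<open>c \<in> critical_points X A f\<close> in simp_all)
      ultimately have "q \<in> post X A f" by simp
      then show False using q by blast
    qed
    then show "y \<in> topspace X - f ` critical_points X A f" using y by blast
  qed
  then have "card (\<Union>y\<in>?F. fibre X f y) \<le> card ?F * map_degree X A f"
    using card_UN_le[of ?F "fibre X f"] Suc.IH by simp
  also have "\<dots> \<le> map_degree X A f ^ n * map_degree X A f" using Suc.IH by simp
  finally show ?case using eq Suc.IH finite_fibre[OF compact_sphere bf]
    by (simp add: mult.commute)
qed

section \<open>Jordan curves and tiles\<close>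

lemma Jordan_curve_nonempty:
  assumes "Jordan_curve_in X J"
  shows "J \<noteq> {}"
proof -
  obtain \<phi> where \<phi>: "homeomorphic_map (top_of_set (sphere (0::complex) 1)) (subtopology X J) \<phi>"
    using assms homeomorphic_space_sym homeomorphic_space unfolding Jordan_curve_in_def by metis
  have "\<phi> 1 \<in> \<phi> ` sphere 0 1" by simp
  then show ?thesis using homeomorphic_imp_surjective_map[OF \<phi>] by auto
qed

lemma Jordan_curve_param:
  assumes "Jordan_curve_in X J" "v \<in> J"
  obtains g :: "real \<Rightarrow> 'a" where "continuous_map (top_of_set {0..1}) X g" "g ` {0..1} = J" "g 0 = v" "g 1 = v"
    "\<And>s t. s \<in> {0..1} \<Longrightarrow> t \<in> {0..1} \<Longrightarrow> g s = g t \<Longrightarrow> s = t \<or> s = 0 \<and> t = 1 \<or> s = 1 \<and> t = 0"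
proof -
  have JX: "J \<subseteq> topspace X" using assms by (simp add: Jordan_curve_in_def)
  obtain \<phi> where \<phi>: "homeomorphic_map (top_of_set (sphere (0::complex) 1)) (subtopology X J) \<phi>"
    using assms homeomorphic_space_sym homeomorphic_space unfolding Jordan_curve_in_def by metis
  have img: "\<phi> ` sphere 0 1 = J"
    using homeomorphic_imp_surjective_map[OF \<phi>] JX by auto
  have inj: "inj_on \<phi> (sphere 0 1)"
    using homeomorphic_imp_injective_map[OF \<phi>] by simp
  obtain z where z: "z \<in> sphere 0 1" "\<phi> z = v" using img assms(2) by blast
  then have nz: "norm z = 1" "z \<noteq> 0" by auto
  define c where "c = circlepath (0::complex) 1"
  have c: "simple_path c" "path_image c = sphere 0 1" by (simp_all add: c_def simple_path_circlepath)
  have c01: "c 0 = 1" "c 1 = 1" by (simp_all add: c_def circlepath)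
  \<comment> \<open>Multiplication by the unit number \<open>z\<close> rotates the standard loop so
    that it starts at the preimage of \<open>v\<close>.\<close>
  define g where "g t = \<phi> (z * c t)" for t
  have cont: "continuous_on {0..1} c" using c(1) simple_path_imp_path path_def by blast
  have cs: "z * c t \<in> sphere 0 1" if "t \<in> {0..1}" for t
  proof -
    have "c t \<in> sphere 0 1" using that c(2) by (auto simp: path_image_def)
    then show ?thesis using nz by (simp add: norm_mult)
  qed
  have 1: "continuous_map (top_of_set {0..1}) X g"
  proof -
    have "continuous_map (top_of_set {0..1}) (top_of_set (sphere 0 1)) (\<lambda>t. z * c t)"
      using cs cont by (auto simp: intro!: continuous_intros)
    moreover have "continuous_map (top_of_set (sphere 0 1)) X \<phi>"
      using homeomorphic_imp_continuous_map[OF \<phi>] by (simp add: continuous_map_in_subtopology)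
    ultimately have "continuous_map (top_of_set {0..1}) X (\<phi> \<circ> (\<lambda>t. z * c t))"
      by (rule continuous_map_compose)
    then show ?thesis by (simp add: g_def[abs_def] o_def)
  qed
  have 2: "g ` {0..1} = J"
  proof -
    have "(\<lambda>t. z * c t) ` {0..1} = sphere 0 1"
    proof
      show "(\<lambda>t. z * c t) ` {0..1} \<subseteq> sphere 0 1" using cs by blast
      show "sphere 0 1 \<subseteq> (\<lambda>t. z * c t) ` {0..1}"
      proof
        fix y assume "y \<in> sphere (0::complex) 1"
        then have "y / z \<in> path_image c" using c(2) nz by (simp add: norm_divide)
        then obtain t where "t \<in> {0..1}" "c t = y / z" by (auto simp: path_image_def)
        then show "y \<in> (\<lambda>t. z * c t) ` {0..1}" using nz by (intro image_eqI[of _ _ t]) auto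
      qed
    qed
    then show ?thesis using img unfolding g_def image_image[of \<phi> "\<lambda>t. z * c t", symmetric] by simp
  qed
  have 3: "s = t \<or> s = 0 \<and> t = 1 \<or> s = 1 \<and> t = 0" if "s \<in> {0..1}" "t \<in> {0..1}" "g s = g t" for s t
  proof -
    have "z * c s = z * c t"
      using that(3) inj_onD[OF inj _ cs[OF that(1)] cs[OF that(2)]] by (simp add: g_def)
    then have "c s = c t" using nz by simp
    then show ?thesis using c(1) that(1,2) unfolding simple_path_def loop_free_def by blast
  qed
  show ?thesis using that[OF 1 2 _ _ 3] z c01 by (simp add: g_def)
qed

context topological_sphere begin

text \<open>The 2-sphere is simply connected and the circle is not. This supplies the puncture used
  in the Jordan curve theorem.\<close>

lemma Jordan_curve_neq_sphere:
  assumes "Jordan_curve_in X J"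
  shows "J \<noteq> topspace X"
proof
  assume "J = topspace X"
  then have "X homeomorphic_space top_of_set (sphere (0::complex) 1)"
    using assms by (simp add: Jordan_curve_in_def)
  then have "sphere (0::complex) 1 homeomorphic sphere (0::real^3) 1"
    using homeomorphic_sphere homeomorphic_space_sym homeomorphic_space_trans
      homeomorphic_space_top_of_set by metis
  then have "simply_connected (sphere (0::complex) 1) \<longleftrightarrow> simply_connected (sphere (0::real^3) 1)"
    by (rule homeomorphic_simply_connected_eq)
  then show False by (simp add: simply_connected_sphere_eq)
qed

text \<open>An open point would be clopen in a connected Hausdorff space, hence the whole space,
  which is infinite.\<close>

lemma singleton_not_open: "\<not> openin X {p}"
proof
  assume o: "openin X {p}"
  then have "p \<in> topspace X" using openin_subset by blast
  then have "closedin X {p}" using Hausdorff_sphere by (simp add: closedin_Hausdorff_sing_eq)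
  then have "{p} = topspace X"
    using o connected_space_sphere unfolding connected_space_clopen_in by blast
  then show False using infinite_sphere by (metis finite.emptyI finite_insert)
qed

text \<open>The Jordan curve theorem in the plane, transported by a puncture \<open>p\<close> off
  \<open>J\<close>. The points \<open>w\<close> and \<open>b\<close> come from the inside and the
  outside. The statement speaks of relatively clopen sets because it is applied to images of
  components under an iterate of \<open>f\<close>.\<close>

lemma Jordan_curve_complement:
  assumes "Jordan_curve_in X J"
  obtains w b where "w \<in> topspace X - J" "b \<in> topspace X - J"
    "\<forall>S. S \<noteq> {} \<longrightarrow> openin X S \<longrightarrow> S \<subseteq> topspace X - J \<longrightarrow> closedin (subtopology X (topspace X - J)) S
      \<longrightarrow> w \<in> S \<or> b \<in> S"
    "X interior_of J = {}"
proof -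
  have JX: "J \<subseteq> topspace X" using assms by (simp add: Jordan_curve_in_def)
  then obtain p where p: "p \<in> topspace X" "p \<notin> J" using Jordan_curve_neq_sphere[OF assms] by blast
  have "J \<noteq> {}"
    using Jordan_curve_nonempty[OF assms] .
  then obtain v where "v \<in> J" by blast
  obtain g :: "real \<Rightarrow> 'a" where g: "continuous_map (top_of_set {0..1}) X g" "g ` {0..1} = J" "g 0 = v" "g 1 = v"
    and ginj: "\<And>s t. s \<in> {0..1} \<Longrightarrow> t \<in> {0..1} \<Longrightarrow> g s = g t \<Longrightarrow> s = t \<or> s = 0 \<and> t = 1 \<or> s = 1 \<and> t = 0"
    using Jordan_curve_param[OF assms \<open>v \<in> J\<close>] by metis
  let ?Y = "subtopology X (topspace X - {p})"
  have tY: "topspace ?Y = topspace X - {p}" by auto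
  obtain h where h: "homeomorphic_map ?Y (euclidean :: complex topology) h"
    using puncture_homeomorphic_plane p by blast
  then obtain k where k: "homeomorphic_maps ?Y euclidean h k"
    using homeomorphic_map_maps by blast
  have hinj: "inj_on h (topspace X - {p})" using homeomorphic_imp_injective_map[OF h] tY by simp
  have kh: "k (h x) = x" if "x \<in> topspace X - {p}" for x
    using k that by (auto simp: homeomorphic_maps_def)
  have hk: "h (k z) = z" "k z \<in> topspace X - {p}" for z
    using k by (auto simp: homeomorphic_maps_def continuous_map_def)
  have gJ: "g t \<in> J" if "t \<in> {0..1}" for t using g(2) that by blast
  have gX: "g t \<in> topspace X - {p}" if "t \<in> {0..1}" for t using gJ[OF that] JX p by blast
  define c where "c = h \<circ> g"
  have "continuous_map (top_of_set {0..1}) ?Y g"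
    using g(1) gX by (simp add: continuous_map_in_subtopology image_subset_iff)
  then have "continuous_map (top_of_set {0..1}) euclidean c"
    unfolding c_def using homeomorphic_imp_continuous_map[OF h] by (rule continuous_map_compose)
  then have pc: "path c" by (simp add: path_def)
  have "loop_free c"
    unfolding loop_free_def
  proof (intro ballI impI)
    fix s t :: real assume st: "s \<in> {0..1}" "t \<in> {0..1}" "c s = c t"
    have "g s = g t" using inj_onD[OF hinj _ gX[OF st(1)] gX[OF st(2)]] st(3) by (simp add: c_def)
    then show "s = t \<or> s = 0 \<and> t = 1 \<or> s = 1 \<and> t = 0" by (rule ginj[OF st(1,2)])
  qed
  then have sc: "simple_path c" using pc by (simp add: simple_path_def)
  have lc: "pathfinish c = pathstart c" by (simp add: c_def pathfinish_def pathstart_def g)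
  have ic: "path_image c = h ` J" using g(2) unfolding path_image_def c_def image_comp[symmetric] by simp
  obtain inner outer where io: "inner \<noteq> {}" "open inner" "connected inner"
                "outer \<noteq> {}" "open outer" "connected outer"
                "bounded inner" "\<not> bounded outer" "inner \<inter> outer = {}"
                "inner \<union> outer = - path_image c"
                "frontier inner = path_image c"
                "frontier outer = path_image c"
    using Jordan_curve[OF sc lc] .
  have kcon: "connectedin X (k ` T)" if "connected T" for T
  proof -
    have "connectedin ?Y (k ` T)"
      using k that connectedin_continuous_map_image[of euclidean ?Y k T]
      by (simp add: homeomorphic_maps_def)
    then show ?thesis by (simp add: connectedin_subtopology)
  qed
  have kJ: "k z \<in> topspace X - J" if "z \<notin> path_image c" for z
    using that hk[of z] unfolding ic by (metis DiffD1 DiffI image_eqI)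
  obtain zi zo where z: "zi \<in> inner" "zo \<in> outer" using io by blast
  \<comment> \<open>A clopen set that meets the connected preimage of one side of the curve contains
    all of it, in particular the marked point there.\<close>
  have fill: "k z \<in> S"
    if S: "openin X S" "S \<subseteq> topspace X - J" "closedin (subtopology X (topspace X - J)) S"
      and I: "connected I" "I \<subseteq> - path_image c" "z \<in> I" "h x \<in> I" and x: "x \<in> S" "x \<noteq> p" for S I z x
  proof -
    have "connectedin (subtopology X (topspace X - J)) (k ` I)"
      using kcon[OF I(1)] kJ I(2) by (auto simp: connectedin_subtopology)
    moreover have "openin (subtopology X (topspace X - J)) S"
      using S by (metis inf.absorb1 openin_subtopology_Int)
    ultimately have "k ` I \<subseteq> S \<or> disjnt (k ` I) S"
      using connectedin_clopen_cases S(3) by metis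
    moreover have "x \<in> k ` I" using kh[of x] x S(2) I(4) by (metis DiffD1 DiffI image_eqI singletonD subsetD)
    ultimately show ?thesis using x(1) I(3) by (auto simp: disjnt_def)
  qed
  have 1: "k zi \<in> S \<or> k zo \<in> S"
    if S: "S \<noteq> {}" "openin X S" "S \<subseteq> topspace X - J" "closedin (subtopology X (topspace X - J)) S" for S
  proof -
    \<comment> \<open>The puncture has no image in the plane, so a second point of \<open>S\<close>
      is required.\<close>
    have "S \<noteq> {p}" using singleton_not_open S(2) by metis
    then obtain x where x: "x \<in> S" "x \<noteq> p" using S(1) by blast
    then have xJ: "x \<in> topspace X - {p}" "x \<notin> J" using S(3) by blast+
    have "h x \<notin> path_image c"
    proof
      assume "h x \<in> path_image c"
      then obtain y where "y \<in> J" "h x = h y" unfolding ic by blast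
      then have "x = y" using inj_onD[OF hinj _ xJ(1)] JX p by blast
      then show False using \<open>y \<in> J\<close> xJ by blast
    qed
    then have "h x \<in> inner \<or> h x \<in> outer" using io(10) by blast
    moreover have "inner \<subseteq> - path_image c" "outer \<subseteq> - path_image c" using io(10) by blast+
    ultimately show ?thesis
      using fill[OF S(2-4) io(3) _ z(1) _ x] fill[OF S(2-4) io(6) _ z(2) _ x] by blast
  qed
  have 2: "X interior_of J = {}"
  proof (rule ccontr)
    let ?W = "X interior_of J"
    assume "?W \<noteq> {}"
    have WJ: "?W \<subseteq> J" by (rule interior_of_subset)
    then have "?W \<subseteq> topspace X - {p}" using JX p by blast
    then have "openin ?Y ?W" by (metis inf.absorb1 openin_interior_of openin_subtopology_Int)
    then have "open (h ` ?W)"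
      using homeomorphic_imp_open_map[OF h] by (simp add: open_map_def)
    \<comment> \<open>Every point of the curve is a frontier point of the inside, so an open subset
      of the curve would have to meet the inside.\<close>
    moreover have "h ` ?W \<subseteq> closure inner" using WJ io(11) unfolding ic frontier_def by blast
    ultimately have "h ` ?W \<inter> inner \<noteq> {}"
      using \<open>?W \<noteq> {}\<close> open_Int_closure_eq_empty by (metis image_is_empty inf.absorb1)
    then show False using WJ io(10) unfolding ic by blast
  qed
  have "zi \<notin> path_image c" "zo \<notin> path_image c" using z io(10) by blast+
  then show ?thesis using that[of "k zi" "k zo"] kJ 1 2 by blast
qed

end

section \<open>Tiles, their covering property and their number\<close>

lemma continuous_map_funpow: "continuous_map X X f \<Longrightarrow> continuous_map X X (f ^^ n)"
  by (induction n) (auto intro: continuous_map_compose simp: continuous_map_id[unfolded id_def] id_def)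

lemma open_map_funpow: "open_map X X f \<Longrightarrow> open_map X X (f ^^ n)"
proof (induction n)
  case (Suc n)
  then show ?case using open_map_compose[of X X "f ^^ n" X f] by (simp only: funpow.simps)
qed (simp add: open_map_def)

lemma Jordan_curve_closedin:
  assumes "Hausdorff_space X" "Jordan_curve_in X J"
  shows "closedin X J"
proof -
  have "compact_space (top_of_set (sphere (0::complex) 1))" by (simp add: compact_space_subtopology)
  then have "compact_space (subtopology X J)"
    using assms(2) homeomorphic_compact_space unfolding Jordan_curve_in_def by metis
  then have "compactin X J" using assms(2) by (simp add: Jordan_curve_in_def compactin_subspace)
  with assms(1) show ?thesis by (rule compactin_imp_closedin)
qed

context topological_sphere begin

text \<open>The image under \<open>f ^^ n\<close> of a component off the preimage of
  \<open>J\<close> is relatively clopen off \<open>J\<close>, so the component contains a point over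
  \<open>w\<close> or \<open>b\<close>. These two values avoid the postcritical set, and each has at
  most \<open>map_degree X A f ^ n\<close> preimages. Finiteness then lets closure commute with the
  union.\<close>

lemma
  assumes f: "Thurston_map X A f" and J: "Jordan_curve_in X J" and postJ: "post X A f \<subseteq> J"
  shows finite_tiles: "finite (tiles X f J n)"
    and card_tiles: "card (tiles X f J n) \<le> 2 * map_degree X A f ^ n"
    and Union_tiles: "\<Union>(tiles X f J n) = topspace X"
    and closedin_tile: "T \<in> tiles X f J n \<Longrightarrow> closedin X T"
    and connectedin_tile: "T \<in> tiles X f J n \<Longrightarrow> connectedin X T"
    and empty_not_tile: "{} \<notin> tiles X f J n"
proof -
  have bf: "branched_covering_map X A f" using f by (simp add: Thurston_map_def)
  let ?F = "f ^^ n" and ?O = "{x \<in> topspace X. (f ^^ n) x \<in> J}"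
  let ?Y = "subtopology X (topspace X - ?O)"
  have tY: "topspace ?Y = topspace X - ?O" by auto
  have cont: "continuous_map X X ?F"
    using bf continuous_map_funpow by (auto simp: branched_covering_map_def)
  have fX: "?F x \<in> topspace X" if "x \<in> topspace X" for x
    using cont that continuous_map_image_subset_topspace by blast
  have opn: "open_map X X ?F" using branched_covering_open_map[OF bf] open_map_funpow by blast
  have cm: "closed_map X X ?F"
    using cont compact_sphere Hausdorff_sphere continuous_imp_closed_map by blast
  have clJ: "closedin X J" using Jordan_curve_closedin Hausdorff_sphere J by blast
  then have clO: "closedin X ?O" using closedin_continuous_map_preimage[OF cont] by simp
  obtain w b where wb: "w \<in> topspace X - J" "b \<in> topspace X - J" and
    clopen: "\<forall>S. S \<noteq> {} \<longrightarrow> openin X S \<longrightarrow> S \<subseteq> topspace X - J \<longrightarrow> closedin (subtopology X (topspace X - J)) S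
      \<longrightarrow> w \<in> S \<or> b \<in> S" and intJ: "X interior_of J = {}"
    using Jordan_curve_complement[OF J] .
  have compU: "U \<noteq> {}" "U \<subseteq> topspace X - ?O" "connectedin X U" "openin X U" "X closure_of U \<inter> (topspace X - ?O) \<subseteq> U"
    if U: "U \<in> connected_components_of ?Y" for U
  proof -
    show "U \<noteq> {}" using nonempty_connected_components_of[OF U] .
    show sub: "U \<subseteq> topspace X - ?O" using connected_components_of_subset[OF U] tY by simp
    show "connectedin X U"
      using connectedin_connected_components_of[OF U] by (simp add: connectedin_subtopology)
    have oY: "openin X (topspace X - ?O)" using clO by blast
    have "locally_connected_space ?Y"
      using locally_connected_sphere locally_connected_space_open_subset oY by blast
    then have "openin ?Y U" using openin_connected_components_of_locally_connected_space U by blast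
    then show "openin X U" using oY openin_trans_full by blast
    have "closedin ?Y U" using closedin_connected_components_of[OF U] .
    then show "X closure_of U \<inter> (topspace X - ?O) \<subseteq> U"
      by (metis closedin_Int_closure_of inf_commute subset_refl)
  qed
  let ?P = "fibre X ?F w \<union> fibre X ?F b"
  have meets: "U \<inter> ?P \<noteq> {}" if U: "U \<in> connected_components_of ?Y" for U
  proof -
    have 1: "?F ` U \<noteq> {}" "openin X (?F ` U)" using compU[OF U] opn by (auto simp: open_map_def)
    have 2: "?F ` U \<subseteq> topspace X - J" using compU(2)[OF U] fX by blast
    \<comment> \<open>Taking the closure of \<open>U\<close> adds only points over \<open>J\<close>.
      Since \<open>?F\<close> is a closed map, the image is therefore closed relative to the
      complement of \<open>J\<close>.\<close>
    have "?F ` U = (topspace X - J) \<inter> ?F ` (X closure_of U)"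
    proof
      have "U \<subseteq> X closure_of U" using compU(2)[OF U] by (intro closure_of_subset) blast
      then show "?F ` U \<subseteq> (topspace X - J) \<inter> ?F ` (X closure_of U)" using 2 by blast
      show "(topspace X - J) \<inter> ?F ` (X closure_of U) \<subseteq> ?F ` U"
      proof clarify
        fix x assume x: "x \<in> X closure_of U" "?F x \<notin> J"
        then have "x \<in> topspace X - ?O" using closure_of_subset_topspace by fastforce
        then show "?F x \<in> ?F ` U" using compU(5)[OF U] x(1) by blast
      qed
    qed
    moreover have "closedin X (?F ` (X closure_of U))"
      using cm closedin_closure_of unfolding closed_map_def by blast
    ultimately have "closedin (subtopology X (topspace X - J)) (?F ` U)"
      by (metis closedin_subtopology_Int_closed)
    then have "w \<in> ?F ` U \<or> b \<in> ?F ` U" using clopen[rule_format, OF 1 2] by simp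
    then obtain x where "x \<in> U" "?F x = w \<or> ?F x = b" by fast
    then show ?thesis using compU(2)[OF U] by auto
  qed
  have finw: "finite (fibre X ?F w)" "card (fibre X ?F w) \<le> map_degree X A f ^ n"
    using card_iterated_fibre[OF f, of w n] wb postJ by blast+
  have finb: "finite (fibre X ?F b)" "card (fibre X ?F b) \<le> map_degree X A f ^ n"
    using card_iterated_fibre[OF f, of b n] wb postJ by blast+
  \<comment> \<open>Every component is the component of one of its points in \<open>?P\<close>, so
    there are at most as many components as points.\<close>
  have comps: "connected_components_of ?Y \<subseteq> connected_component_of_set ?Y ` ?P"
  proof
    fix U assume U: "U \<in> connected_components_of ?Y"
    then obtain x where x: "x \<in> U" "x \<in> ?P" using meets by blast
    obtain y where "U = connected_component_of_set ?Y y"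
      using U by (auto simp: connected_components_of_def)
    moreover from this have "connected_component_of ?Y y x" using x(1) by simp
    then have "connected_component_of ?Y y = connected_component_of ?Y x"
      by (simp add: connected_component_of_equiv)
    ultimately have "U = connected_component_of_set ?Y x" by simp
    then show "U \<in> connected_component_of_set ?Y ` ?P" using x(2) by blast
  qed
  have finP: "finite ?P" using finw finb by simp
  have cardP: "card ?P \<le> 2 * map_degree X A f ^ n"
    using card_Un_le[of "fibre X ?F w" "fibre X ?F b"] finw(2) finb(2) by linarith
  have fincomp: "finite (connected_components_of ?Y)"
    by (rule finite_subset[OF comps finite_imageI[OF finP]])
  have "card (connected_components_of ?Y) \<le> card ?P"
    using card_mono[OF finite_imageI[OF finP] comps] card_image_le[OF finP] by (rule order_trans)
  moreover have "card (tiles X f J n) \<le> card (connected_components_of ?Y)"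
    unfolding tiles_def by (rule card_image_le[OF fincomp])
  ultimately show "card (tiles X f J n) \<le> 2 * map_degree X A f ^ n" using cardP by linarith
  show "finite (tiles X f J n)" unfolding tiles_def using fincomp by (rule finite_imageI)
  show "closedin X T" if "T \<in> tiles X f J n"
    using that by (auto simp: tiles_def)
  show "connectedin X T" if "T \<in> tiles X f J n"
    using that compU(3) connectedin_closure_of by (auto simp: tiles_def)
  show "{} \<notin> tiles X f J n"
  proof
    assume "{} \<in> tiles X f J n"
    then obtain U where U: "U \<in> connected_components_of ?Y" "X closure_of U = {}"
      by (auto simp: tiles_def)
    then show False using compU(1,2)[OF U(1)] closure_of_subset[of U X] by blast
  qed
  \<comment> \<open>An iterate of an open map is open, so an open set over \<open>J\<close> would
    have an open image inside \<open>J\<close>.\<close>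
  have intO: "X interior_of ?O = {}"
  proof -
    have "?F ` (X interior_of ?O) \<subseteq> J" using interior_of_subset by fastforce
    moreover have "openin X (?F ` (X interior_of ?O))" using opn by (simp add: open_map_def)
    ultimately have "?F ` (X interior_of ?O) \<subseteq> X interior_of J" by (simp add: interior_of_maximal)
    then show ?thesis using intJ by blast
  qed
  have "\<Union>(tiles X f J n) = X closure_of \<Union>(connected_components_of ?Y)"
    unfolding tiles_def using closure_of_Union[OF fincomp] by simp
  also have "\<Union>(connected_components_of ?Y) = topspace X - ?O"
    using Union_connected_components_of tY by metis
  also have "X closure_of \<dots> = topspace X - X interior_of ?O" by (rule closure_of_complement)
  finally show "\<Union>(tiles X f J n) = topspace X" using intO by simp
qed

end

section \<open>Edges\<close>

text \<open>The loop starts at a vertex, so each edge is the image of one parameter interval and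
  none runs across the seam \<open>g 0 = g 1\<close>.\<close>

locale parametrised_Jordan_curve =
  fixes X :: "'a topology" and J P :: "'a set" and g :: "real \<Rightarrow> 'a"
  assumes Hausdorff: "Hausdorff_space X"
    and continuous: "continuous_map (top_of_set {0..1}) X g"
    and image: "g ` {0..1} = J"
    and closed: "g 0 = g 1"
    and injective: "s \<in> {0..1} \<Longrightarrow> t \<in> {0..1} \<Longrightarrow> g s = g t \<Longrightarrow> s = t \<or> s = 0 \<and> t = 1 \<or> s = 1 \<and> t = 0"
    and finite_vertices: "finite P"
    and base_vertex: "g 0 \<in> P"
begin

lemma closedin_arc:
  assumes "{s..t} \<subseteq> {0..1}"
  shows "closedin X (g ` {s..t})"
proof -
  have "compactin (top_of_set {0..1}) {s..t}"
    using assms by (simp add: compactin_subtopology)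
  then have "compactin X (g ` {s..t})" using continuous by (rule image_compactin)
  with Hausdorff show ?thesis by (rule compactin_imp_closedin)
qed

lemma connectedin_image:
  assumes "connected I" "I \<subseteq> {0..1}"
  shows "connectedin X (g ` I)"
proof (rule connectedin_continuous_map_image[OF continuous])
  show "connectedin (top_of_set {0..1}) I" using assms by (simp add: connectedin_subtopology)
qed

lemma J_subset: "J \<subseteq> topspace X"
  using connectedin_image[of "{0..1}"] image connectedin_subset_topspace by fastforce

text \<open>The open arc between consecutive vertices is connected and clopen in
  \<open>J - P\<close>, hence equals any component that it meets.\<close>

lemma open_arc_component:
  assumes st: "0 \<le> s" "s < t" "t \<le> 1" and P: "g s \<in> P" "g t \<in> P" "\<And>u. s < u \<Longrightarrow> u < t \<Longrightarrow> g u \<notin> P"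
    and C: "C \<in> connected_components_of (subtopology X (J - P))" and u: "s < u" "u < t" "g u \<in> C"
  shows "C = g ` {s<..<t}"
proof
  let ?Y = "subtopology X (J - P)" and ?K = "g ` {s<..<t}"
  have tY: "topspace ?Y = J - P" using J_subset by auto
  have KJ: "?K \<subseteq> J - P" using st P(3) image by fastforce
  have "connectedin X ?K" using st by (intro connectedin_image) auto
  then have Kcon: "connectedin ?Y ?K" using KJ by (simp add: connectedin_subtopology)
  have "g u \<in> ?K" using u by simp
  then have "\<not> disjnt C ?K" using u by (auto simp: disjnt_def)
  then show "?K \<subseteq> C" using connected_components_of_maximal[OF C Kcon] by blast
  have "?K = (J - P) \<inter> g ` {s..t}"
  proof
    show "?K \<subseteq> (J - P) \<inter> g ` {s..t}" using KJ by auto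
    show "(J - P) \<inter> g ` {s..t} \<subseteq> ?K"
    proof clarify
      fix x assume "x \<in> {s..t}" "g x \<notin> P"
      then have "x \<noteq> s" "x \<noteq> t" using P by auto
      then show "g x \<in> ?K" using \<open>x \<in> {s..t}\<close> by auto
    qed
  qed
  moreover have "closedin X (g ` {s..t})" using st by (intro closedin_arc) auto
  ultimately have 1: "closedin ?Y ?K" by (metis closedin_subtopology_Int_closed)
  \<comment> \<open>For openness: by injectivity, the rest of the curve is made up of the two closed
    arcs on either side.\<close>
  have "?K = (J - P) - (g ` {0..s} \<union> g ` {t..1})"
  proof
    show "?K \<subseteq> (J - P) - (g ` {0..s} \<union> g ` {t..1})"
    proof clarify
      fix x assume x: "x \<in> {s<..<t}"
      have "g x \<noteq> g y" if "y \<in> {0..s} \<union> {t..1}" for y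
        using injective[of x y] x st that by auto
      then show "g x \<in> (J - P) - (g ` {0..s} \<union> g ` {t..1})" using x KJ by blast
    qed
    show "(J - P) - (g ` {0..s} \<union> g ` {t..1}) \<subseteq> ?K"
    proof
      fix z assume z: "z \<in> (J - P) - (g ` {0..s} \<union> g ` {t..1})"
      then obtain y where y: "y \<in> {0..1}" "z = g y" using image by blast
      then have "y \<notin> {0..s}" "y \<notin> {t..1}" using z by blast+
      then have "y \<in> {s<..<t}" using y(1) by auto
      then show "z \<in> ?K" using y(2) by blast
    qed
  qed
  moreover have "closedin X (g ` {0..s} \<union> g ` {t..1})"
    using st by (intro closedin_Un closedin_arc) auto
  then have "closedin ?Y ((J - P) \<inter> (g ` {0..s} \<union> g ` {t..1}))"
    by (rule closedin_subtopology_Int_closed)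
  then have "openin ?Y (topspace ?Y - (J - P) \<inter> (g ` {0..s} \<union> g ` {t..1}))" by blast
  moreover have "topspace ?Y - (J - P) \<inter> (g ` {0..s} \<union> g ` {t..1}) = (J - P) - (g ` {0..s} \<union> g ` {t..1})"
    unfolding tY by blast
  ultimately have 2: "openin ?Y ?K" by simp
  have "connectedin ?Y C" using connectedin_connected_components_of[OF C] .
  then have "C \<subseteq> ?K \<or> disjnt C ?K" using connectedin_clopen_cases 1 2 by metis
  then show "C \<subseteq> ?K" using \<open>\<not> disjnt C ?K\<close> by blast
qed

lemma closure_of_open_arc:
  assumes st: "0 \<le> s" "s < t" "t \<le> 1"
  shows "X closure_of (g ` {s<..<t}) = g ` {s..t}"
proof
  show "X closure_of (g ` {s<..<t}) \<subseteq> g ` {s..t}"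
    using st by (intro closure_of_minimal closedin_arc) auto
  have "top_of_set {0..1} closure_of {s<..<t} = {0..1} \<inter> closure ({0..1} \<inter> {s<..<t})"
    by (simp add: closure_of_subtopology)
  also have "{0..1} \<inter> {s<..<t} = {s<..<t}" using st by auto
  also have "{0..1} \<inter> closure {s<..<t} = {s..t}" using st by auto
  finally show "g ` {s..t} \<subseteq> X closure_of (g ` {s<..<t})"
    using continuous_map_image_closure_subset[OF continuous] by metis
qed

lemma closed_arc_edge:
  assumes st: "0 \<le> s" "s < t" "t \<le> 1" and P: "g s \<in> P" "g t \<in> P" "\<And>u. s < u \<Longrightarrow> u < t \<Longrightarrow> g u \<notin> P"
  shows "g ` {s..t} \<in> (\<lambda>K. X closure_of K) ` connected_components_of (subtopology X (J - P))"
proof -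
  let ?Y = "subtopology X (J - P)" and ?u = "(s + t) / 2"
  have u: "s < ?u" "?u < t" using st by auto
  have "g ?u \<in> J - P" using st u P(3)[OF u] image by force
  then have "g ?u \<in> topspace ?Y" using J_subset by auto
  then obtain C where C: "C \<in> connected_components_of ?Y" "g ?u \<in> C"
    using Union_connected_components_of by (metis UnionE)
  have "C = g ` {s<..<t}" by (rule open_arc_component[OF st P C(1) u C(2)])
  then show ?thesis using closure_of_open_arc[OF st] C(1) by force
qed

text \<open>The half-open interval counts the base vertex only once.\<close>

definition vertex_params :: "real set" where
  "vertex_params = {u \<in> {0..<1}. g u \<in> P}"

lemma inj_on_half_open: "inj_on g {0..<1}"
  using injective by (force intro!: inj_onI)

lemma finite_vertex_params: "finite vertex_params"
proof (rule inj_on_finite[OF _ _ finite_vertices])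
  show "inj_on g vertex_params"
    using inj_on_half_open by (rule inj_on_subset) (auto simp: vertex_params_def)
qed (auto simp: vertex_params_def)

lemma card_vertex_params:
  assumes "P \<subseteq> J"
  shows "card vertex_params = card P"
proof -
  have "g ` vertex_params = P"
  proof
    show "P \<subseteq> g ` vertex_params"
    proof
      fix x assume x: "x \<in> P"
      then obtain u where u: "u \<in> {0..1}" "x = g u" using assms image by blast
      show "x \<in> g ` vertex_params"
      proof (cases "u = 1")
        case True
        then show ?thesis using u x closed by (intro image_eqI[of _ _ 0]) (auto simp: vertex_params_def)
      next
        case False
        then show ?thesis using u x by (intro image_eqI[of _ _ u]) (auto simp: vertex_params_def)
      qed
    qed
  qed (auto simp: vertex_params_def)
  moreover have "inj_on g vertex_params"
    using inj_on_half_open by (rule inj_on_subset) (auto simp: vertex_params_def)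
  ultimately show ?thesis using card_image by metis
qed

text \<open>The edge runs from the last vertex parameter up to \<open>u\<close> to the next one. The
  bound \<open>r \<le> a\<close> will keep it away from edges that end before
  \<open>r\<close>.\<close>

lemma edge_through_param:
  assumes u: "u \<in> {0..1}" and r: "r \<in> vertex_params" "r \<le> u"
  obtains a b where "a \<in> vertex_params" "r \<le> a" "a \<le> u" "u \<le> b" "b \<le> 1"
    "g ` {a..b} \<in> (\<lambda>K. X closure_of K) ` connected_components_of (subtopology X (J - P))"
proof -
  define a where "a = Max {x \<in> vertex_params. x \<le> u}"
  \<comment> \<open>The parameter \<open>1\<close> is added because it is a second parameter of the
    base vertex, where the last edge ends.\<close>
  define b where "b = Min {x \<in> insert 1 vertex_params. a < x}"
  have finA: "finite {x \<in> vertex_params. x \<le> u}" using finite_vertex_params by simp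
  have "a \<in> {x \<in> vertex_params. x \<le> u}" unfolding a_def using finA r by (intro Max_in) auto
  then have a: "a \<in> vertex_params" "a \<le> u" by auto
  have amax: "x \<le> a" if "x \<in> vertex_params" "x \<le> u" for x
    unfolding a_def using finA that by (intro Max_ge) auto
  have "a < 1" "0 \<le> a" using a by (auto simp: vertex_params_def)
  have finB: "finite {x \<in> insert 1 vertex_params. a < x}" using finite_vertex_params by simp
  have "b \<in> {x \<in> insert 1 vertex_params. a < x}"
    unfolding b_def using finB \<open>a < 1\<close> by (intro Min_in) auto
  then have b: "b \<in> insert 1 vertex_params" "a < b" by auto
  have bmin: "b \<le> x" if "x \<in> insert 1 vertex_params" "a < x" for x
    unfolding b_def using finB that by (intro Min_le) auto
  have "b \<le> 1" using b by (auto simp: vertex_params_def)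
  have "u \<le> b"
  proof (rule ccontr)
    assume "\<not> u \<le> b"
    then have "b \<in> vertex_params" using b(1) u by auto
    then show False using amax[of b] b(2) \<open>\<not> u \<le> b\<close> by simp
  qed
  have ga: "g a \<in> P" using a by (simp add: vertex_params_def)
  have gb: "g b \<in> P" using b closed base_vertex by (auto simp: vertex_params_def)
  have "g x \<notin> P" if "a < x" "x < b" for x
    using bmin[of x] that \<open>0 \<le> a\<close> \<open>b \<le> 1\<close> by (auto simp: vertex_params_def)
  then have "g ` {a..b} \<in> (\<lambda>K. X closure_of K) ` connected_components_of (subtopology X (J - P))"
    using \<open>0 \<le> a\<close> b(2) \<open>b \<le> 1\<close> ga gb by (intro closed_arc_edge) auto
  then show ?thesis using that a amax[OF r] \<open>u \<le> b\<close> \<open>b \<le> 1\<close> by blast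
qed

lemma arcs_meet:
  assumes "x \<in> {0..1}" "y \<in> {0<..<1}" "g x = g y"
  shows "x = y"
  using injective[of x y] assms by auto

end

section \<open>Four arcs in cyclic order\<close>

lemma finite_linorder_remove_Min:
  fixes S :: "'b::linorder set"
  assumes "finite S" "S \<noteq> {}"
  obtains m where "m \<in> S" "\<And>x. x \<in> S - {m} \<Longrightarrow> m < x" "card S = Suc (card (S - {m}))"
proof (rule that[of "Min S"])
  show "Min S \<in> S" using assms by simp
  show "Min S < x" if "x \<in> S - {Min S}" for x using that assms Min_le[of S x] by (auto simp: less_le)
  show "card S = Suc (card (S - {Min S}))" using assms by (metis Min_in card_Suc_Diff1)
qed

text \<open>\<open>E\<close> and \<open>G\<close> are separated on the curve by the arcs \<open>B\<close> and \<open>B'\<close>. If there are at least four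
  vertices, \<open>E\<close>, \<open>B\<close>, \<open>G\<close> are consecutive edges and \<open>B'\<close> is the union of all others; if there are
  three, \<open>E\<close>, \<open>B\<close>, \<open>B'\<close> are the edges and \<open>G\<close> is the vertex opposite to \<open>E\<close>.\<close>

lemma zero_edge_quadrilateral:
  assumes X: "Hausdorff_space X" and J: "Jordan_curve_in X J"
    and P: "finite (post X A f)" "post X A f \<subseteq> J" "card (post X A f) \<ge> 3"
  obtains E G B B' where "E \<noteq> {}" "G \<noteq> {}" "connectedin X (E \<union> B \<union> G)" "connectedin X (E \<union> B' \<union> G)"
    "\<forall>K. K \<inter> E \<noteq> {} \<longrightarrow> K \<inter> G \<noteq> {} \<longrightarrow> joins_opposite_sides X A f J K"
    "\<forall>K. K \<inter> E \<noteq> {} \<longrightarrow> K \<inter> B \<noteq> {} \<longrightarrow> K \<inter> B' \<noteq> {} \<longrightarrow> joins_opposite_sides X A f J K"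
proof -
  let ?P = "post X A f"
  have "?P \<noteq> {}" using P(3) by auto
  then obtain v where v: "v \<in> ?P" by blast
  obtain g :: "real \<Rightarrow> 'a" where g: "continuous_map (top_of_set {0..1}) X g" "g ` {0..1} = J" "g 0 = v" "g 1 = v"
    and ginj: "\<And>s t. s \<in> {0..1} \<Longrightarrow> t \<in> {0..1} \<Longrightarrow> g s = g t \<Longrightarrow> s = t \<or> s = 0 \<and> t = 1 \<or> s = 1 \<and> t = 0"
    using Jordan_curve_param[OF J, of v] v P(2) by blast
  interpret parametrised_Jordan_curve X J ?P g
    by unfold_locales (use X g ginj P v in auto)
  let ?V = vertex_params
  have edges: "zero_edges X A f J = (\<lambda>K. X closure_of K) ` connected_components_of (subtopology X (J - ?P))"
    by (simp add: zero_edges_def)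
  have cV: "card ?V \<ge> 3" using card_vertex_params P by simp
  have V0: "0 \<in> ?V" using base_vertex by (simp add: vertex_params_def)
  have V01: "u \<in> {0..<1}" "g u \<in> ?P" if "u \<in> ?V" for u using that by (auto simp: vertex_params_def)
  have cV0: "card ?V = Suc (card (?V - {0}))" using V0 finite_vertex_params by (metis card_Suc_Diff1)
  then have c0: "card (?V - {0}) \<ge> 2" using cV by linarith
  then have "?V - {0} \<noteq> {}" by (metis card.empty not_numeral_le_zero)
  \<comment> \<open>The vertex parameters after \<open>0\<close> are taken off in increasing order;
    the cardinalities record whether a third one, \<open>t3\<close>, is left.\<close>
  then obtain t1 where t1: "t1 \<in> ?V - {0}" "\<And>x. x \<in> ?V - {0} - {t1} \<Longrightarrow> t1 < x" "card (?V - {0}) = Suc (card (?V - {0} - {t1}))"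
    using finite_linorder_remove_Min[of "?V - {0}"] finite_vertex_params by blast
  have "card (?V - {0} - {t1}) \<ge> 1" using c0 t1(3) by linarith
  then have "?V - {0} - {t1} \<noteq> {}" by (metis card.empty not_one_le_zero)
  then obtain t2 where t2: "t2 \<in> ?V - {0} - {t1}" "\<And>x. x \<in> ?V - {0} - {t1} - {t2} \<Longrightarrow> t2 < x"
      "card (?V - {0} - {t1}) = Suc (card (?V - {0} - {t1} - {t2}))"
    using finite_linorder_remove_Min[of "?V - {0} - {t1}"] finite_vertex_params by blast
  have ord: "0 < t1" "t1 < t2" "t2 < 1"
    using t1(1) t2(1) t1(2)[OF t2(1)] V01[of t1] V01[of t2] by auto
  have gap1: "g u \<notin> ?P" if "0 < u" "u < t1" for u
    using that ord t1(2)[of u] by (force simp: vertex_params_def)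
  have gap2: "g u \<notin> ?P" if "t1 < u" "u < t2" for u
    using that ord t2(2)[of u] by (force simp: vertex_params_def)
  have gP: "g t1 \<in> ?P" "g t2 \<in> ?P" "g 0 \<in> ?P" "g 1 \<in> ?P" 
    using V01(2)[of t1] V01(2)[of t2] t1(1) t2(1) base_vertex closed by simp_all
  let ?E = "g ` {0..t1}" and ?B = "g ` {t1..t2}"
  have Eedge: "?E \<in> zero_edges X A f J" unfolding edges using ord gP gap1 by (intro closed_arc_edge) auto
  have Bedge: "?B \<in> zero_edges X A f J" unfolding edges using ord gP gap2 by (intro closed_arc_edge) auto
  \<comment> \<open>One statement serves both cases: \<open>t3 = t2\<close> shrinks the third arc to
    a vertex, otherwise \<open>t3\<close> is the next vertex parameter. The second union closes up
    through \<open>g 0 = g 1\<close>.\<close>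
  have con: "connectedin X (?E \<union> ?B \<union> g ` {t2..t3})" "connectedin X (?E \<union> g ` {t3..1} \<union> g ` {t2..t3})"
    if t3: "t2 \<le> t3" "t3 \<le> 1" for t3
  proof -
    have "?E \<union> ?B \<union> g ` {t2..t3} = g ` ({0..t1} \<union> {t1..t2} \<union> {t2..t3})" by (simp only: image_Un)
    also have "{0..t1} \<union> {t1..t2} \<union> {t2..t3} = {0..t3}" using ord t3 by auto
    finally show "connectedin X (?E \<union> ?B \<union> g ` {t2..t3})"
      using t3 by (simp add: connectedin_image)
    have "g ` {t3..1} \<union> g ` {t2..t3} = g ` ({t2..t3} \<union> {t3..1})" by (simp only: image_Un Un_commute)
    also have "{t2..t3} \<union> {t3..1} = {t2..1}" using t3 by auto
    finally have eq: "?E \<union> g ` {t3..1} \<union> g ` {t2..t3} = ?E \<union> g ` {t2..1}" by (simp only: Un_assoc)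
    have "g 0 \<in> ?E" using ord by (intro imageI) simp
    moreover have "g 0 \<in> g ` {t2..1}" unfolding closed using ord by (intro imageI) simp
    ultimately have "?E \<inter> g ` {t2..1} \<noteq> {}" by blast
    then show "connectedin X (?E \<union> g ` {t3..1} \<union> g ` {t2..t3})"
      unfolding eq using ord by (intro connectedin_Un connectedin_image) simp_all
  qed
  show ?thesis
  proof (cases "card ?P = 3")
    case True
    have "card (?V - {0} - {t1} - {t2}) = 0"
      using True card_vertex_params[OF P(2)] cV0 t1(3) t2(3) by simp
    then have "?V - {0} - {t1} - {t2} = {}" using finite_vertex_params by simp
    then have V: "?V = {0, t1, t2}" using V0 t1(1) t2(1) by blast
    let ?B' = "g ` {t2..1}"
    have gap3: "g u \<notin> ?P" if "t2 < u" "u < 1" for u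
    proof
      assume "g u \<in> ?P"
      then have "u \<in> ?V" using that ord by (simp add: vertex_params_def)
      then show False using V that ord by auto
    qed
    \<comment> \<open>With three vertices, every component of the complement contains a point
      strictly between consecutive vertex parameters and is thus one of three open arcs.\<close>
    have all: "e = ?E \<or> e = ?B \<or> e = ?B'" if e: "e \<in> zero_edges X A f J" for e
    proof -
      obtain C where C: "C \<in> connected_components_of (subtopology X (J - ?P))" "e = X closure_of C"
        using e unfolding edges by blast
      have "C \<noteq> {}" "C \<subseteq> J - ?P"
        using nonempty_connected_components_of[OF C(1)] connected_components_of_subset[OF C(1)] by auto
      then obtain u where u: "u \<in> {0..1}" "g u \<in> C" "g u \<notin> ?P" using image by blast
      then have "u \<noteq> 0" "u \<noteq> 1" "u \<noteq> t1" "u \<noteq> t2" using gP by metis+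
      then consider "0 < u" "u < t1" | "t1 < u" "u < t2" | "t2 < u" "u < 1" using u(1) by fastforce
      then show ?thesis
      proof cases
        case 1
        then show ?thesis
          using open_arc_component[of 0 t1 C u] closure_of_open_arc[of 0 t1] C u gP gap1 ord by simp
      next
        case 2
        then show ?thesis
          using open_arc_component[of t1 t2 C u] closure_of_open_arc[of t1 t2] C u gP gap2 ord by simp
      next
        case 3
        then show ?thesis
          using open_arc_component[of t2 1 C u] closure_of_open_arc[of t2 1] C u gP gap3 ord by simp
      qed
    qed
    have J2: "\<forall>K. K \<inter> ?E \<noteq> {} \<longrightarrow> K \<inter> ?B \<noteq> {} \<longrightarrow> K \<inter> ?B' \<noteq> {} \<longrightarrow> joins_opposite_sides X A f J K"
    proof (intro allI impI)
      fix K assume K: "K \<inter> ?E \<noteq> {}" "K \<inter> ?B \<noteq> {}" "K \<inter> ?B' \<noteq> {}"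
      have "K \<inter> e \<noteq> {}" if "e \<in> zero_edges X A f J" for e using all[OF that] K by metis
      then show "joins_opposite_sides X A f J K" using True by (simp add: joins_opposite_sides_def)
    qed
    \<comment> \<open>The vertex \<open>g t2\<close> belongs to both edges other than
      \<open>?E\<close>, so a set that meets \<open>?E\<close> and contains it meets all three
      edges.\<close>
    have J1: "\<forall>K. K \<inter> ?E \<noteq> {} \<longrightarrow> K \<inter> g ` {t2..t2} \<noteq> {} \<longrightarrow> joins_opposite_sides X A f J K"
    proof (intro allI impI)
      fix K assume K: "K \<inter> ?E \<noteq> {}" "K \<inter> g ` {t2..t2} \<noteq> {}"
      have "g t2 \<in> K" using K(2) by simp
      moreover have "g t2 \<in> ?B" "g t2 \<in> ?B'" using ord by (simp_all add: imageI)
      ultimately have "K \<inter> ?B \<noteq> {}" "K \<inter> ?B' \<noteq> {}" by blast+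
      then show "joins_opposite_sides X A f J K" using J2 K(1) by simp
    qed
    have "t2 \<le> t2" "t2 \<le> 1" using ord by auto
    from that[OF _ _ con[OF this] J1 J2] show ?thesis using ord by simp
  next
    case False
    then have "card (?V - {0} - {t1} - {t2}) \<noteq> 0"
      using P(3) card_vertex_params[OF P(2)] cV0 t1(3) t2(3) by simp
    then have "?V - {0} - {t1} - {t2} \<noteq> {}" by (metis card.empty)
    then obtain t3 where t3: "t3 \<in> ?V - {0} - {t1} - {t2}" "\<And>x. x \<in> ?V - {0} - {t1} - {t2} - {t3} \<Longrightarrow> t3 < x"
      using finite_linorder_remove_Min[of "?V - {0} - {t1} - {t2}"] finite_vertex_params by blast
    have ord3: "t2 < t3" "t3 < 1" using t2(2)[OF t3(1)] V01[of t3] t3(1) by auto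
    have gap3: "g u \<notin> ?P" if "t2 < u" "u < t3" for u
      using that ord ord3 t3(2)[of u] by (force simp: vertex_params_def)
    let ?G = "g ` {t2..t3}" and ?B' = "g ` {t3..1}"
    have Gedge: "?G \<in> zero_edges X A f J"
      unfolding edges using ord ord3 gP gap3 t3(1) V01[of t3] by (intro closed_arc_edge) auto
    have EG: "?E \<inter> ?G = {}"
    proof (rule ccontr)
      assume "?E \<inter> ?G \<noteq> {}"
      then obtain x y where "x \<in> {0..t1}" "y \<in> {t2..t3}" "g x = g y" by blast
      then show False using arcs_meet[of x y] ord ord3 by auto
    qed
    have ge4: "4 \<le> card ?P" using False P(3) by linarith
    have J1: "\<forall>K. K \<inter> ?E \<noteq> {} \<longrightarrow> K \<inter> ?G \<noteq> {} \<longrightarrow> joins_opposite_sides X A f J K"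
      unfolding joins_opposite_sides_def using ge4 EG Eedge Gedge by metis
    \<comment> \<open>\<open>?B'\<close> may consist of several edges. The one through the given
      point starts at \<open>t3\<close> or later and is therefore disjoint from
      \<open>?B\<close>.\<close>
    have "joins_opposite_sides X A f J K" if KB: "K \<inter> ?B \<noteq> {}" and KB': "K \<inter> ?B' \<noteq> {}" for K
    proof -
      obtain u where u: "u \<in> {t3..1}" "g u \<in> K" using KB' by blast
      have "u \<in> {0..1}" "t3 \<in> ?V" "t3 \<le> u" using u(1) t3(1) ord ord3 by auto
      then obtain a b where "a \<in> ?V" and ab: "t3 \<le> a" "a \<le> u" "u \<le> b" "b \<le> 1"
        "g ` {a..b} \<in> zero_edges X A f J"
        unfolding edges by (rule edge_through_param)
      have BG: "?B \<inter> g ` {a..b} = {}"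
      proof (rule ccontr)
        assume "?B \<inter> g ` {a..b} \<noteq> {}"
        then obtain z where "z \<in> ?B" "z \<in> g ` {a..b}" by blast
        then obtain x y where "x \<in> {a..b}" "y \<in> {t1..t2}" "g x = g y" by (metis imageE)
        then show False using arcs_meet[of x y] ord ord3 ab by auto
      qed
      have "K \<inter> g ` {a..b} \<noteq> {}" using u ab by auto
      then show ?thesis
        unfolding joins_opposite_sides_def using ge4 KB BG Bedge ab(5) by metis
    qed
    then have J2: "\<forall>K. K \<inter> ?E \<noteq> {} \<longrightarrow> K \<inter> ?B \<noteq> {} \<longrightarrow> K \<inter> ?B' \<noteq> {} \<longrightarrow> joins_opposite_sides X A f J K"
      by blast
    have "t2 \<le> t3" "t3 \<le> 1" using ord3 by auto
    from that[OF _ _ con[OF this] J1 J2] show ?thesis using ord ord3 by simp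
  qed
qed

section \<open>The upper bound for \<open>D\<close>\<close>

lemma D_le_card:
  assumes "finite S" "S \<subseteq> tiles X f J n" "connectedin X (\<Union>S)" "joins_opposite_sides X A f J (\<Union>S)"
  shows "D X A f J n \<le> card S"
proof -
  \<comment> \<open>\<open>D\<close> is defined by indexed families, so the set \<open>S\<close> is
    enumerated by \<open>1\<close> to \<open>card S\<close> to give an admissible one.\<close>
  obtain h where h: "bij_betw h {1..card S} S" using ex_bij_betw_nat_finite_1[OF assms(1)] by blast
  then have im: "h ` {1..card S} = S" by (simp add: bij_betw_def)
  show ?thesis unfolding D_def
  proof (rule Least_le, intro exI[of _ h] conjI ballI)
    show "h i \<in> tiles X f J n" if "i \<in> {1..card S}" for i using that im assms(2) by blast
  qed (use im assms(3,4) in simp_all)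
qed

theorem proposition6p9:
  fixes X :: "'a topology" and A :: "'a chart set" and f :: "'a \<Rightarrow> 'a" and J :: "'a set"
  assumes "oriented_sphere X A"
    and "Thurston_map X A f"
    and "no_periodic_critical_points X A f"
    and "Jordan_curve_in X J"
    and "f ` J \<subseteq> J"
    and "post X A f \<subseteq> J"
  shows "\<exists>C::real. C > 0 \<and>
           (\<forall>n::nat. real (D X A f J n) \<le> C * real (map_degree X A f) powr (real n / 2))"
proof -
  interpret topological_sphere X
    using assms(1) by (simp add: topological_sphere_def oriented_sphere_def)
  let ?d = "real (map_degree X A f)"
  have d: "?d \<ge> 2" and fin: "finite (post X A f)" using assms(2) by (auto simp: Thurston_map_def)
  have powr1: "?d powr (real n / 2) \<ge> 1" for n using d by (intro ge_one_powr_ge_zero) auto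
  show ?thesis
  proof (cases "card (post X A f) < 3")
    case True
    then have no: "\<not> joins_opposite_sides X A f J K" for K by (auto simp: joins_opposite_sides_def)
    \<comment> \<open>No set joins opposite sides, so \<open>D\<close> is a junk value, but the same one for all \<open>n\<close>.\<close>
    define c where "c = (LEAST N::nat. False)"
    have Dc: "D X A f J n = c" for n unfolding D_def c_def by (simp add: no)
    \<comment> \<open>The added \<open>1\<close> keeps the constant positive when \<open>c\<close>
      is zero.\<close>
    have "real (D X A f J n) \<le> (real c + 1) * ?d powr (real n / 2)" for n
    proof -
      have "real c \<le> (real c + 1) * 1" by simp
      also have "\<dots> \<le> (real c + 1) * ?d powr (real n / 2)" by (rule mult_left_mono[OF powr1]) simp
      finally show ?thesis by (simp add: Dc)
    qed
    then show ?thesis by (intro exI[of _ "real c + 1"]) simp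
  next
    case False
    then have "card (post X A f) \<ge> 3" by simp
    then obtain E G B B' where ne: "E \<noteq> {}" "G \<noteq> {}" and con: "connectedin X (E \<union> B \<union> G)" "connectedin X (E \<union> B' \<union> G)"
      and EG: "\<forall>K. K \<inter> E \<noteq> {} \<longrightarrow> K \<inter> G \<noteq> {} \<longrightarrow> joins_opposite_sides X A f J K"
      and EBB: "\<forall>K. K \<inter> E \<noteq> {} \<longrightarrow> K \<inter> B \<noteq> {} \<longrightarrow> K \<inter> B' \<noteq> {} \<longrightarrow> joins_opposite_sides X A f J K"
      by (rule zero_edge_quadrilateral[OF Hausdorff_sphere assms(4) fin assms(6)])
    have "real (D X A f J n) \<le> 4 * ?d powr (real n / 2)" for n
    proof -
      let ?N = "D X A f J n" and ?x = "?d powr (real n / 2)"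
      note tiles = finite_tiles[OF assms(2,4,6), of n] card_tiles[OF assms(2,4,6), of n]
        Union_tiles[OF assms(2,4,6), of n] closedin_tile[OF assms(2,4,6), of _ n]
        connectedin_tile[OF assms(2,4,6), of _ n] empty_not_tile[OF assms(2,4,6), of n]
      \<comment> \<open>The lower bound is used with \<open>D\<close> itself as \<open>N\<close>: by
        the choice of the four arcs, the families in its two hypotheses join opposite sides.\<close>
      have "?N * (?N - 1) \<le> 2 * card (tiles X f J n) + 2"
      proof (rule tile_count_lower_bound[OF tiles(1,4,5,6,3) ne con])
        show "?N \<le> card S" if "S \<subseteq> tiles X f J n" "connectedin X (\<Union>S)" "\<Union>S \<inter> E \<noteq> {}" "\<Union>S \<inter> G \<noteq> {}" for S
          using that EG finite_subset[OF that(1) tiles(1)] by (intro D_le_card) auto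
        show "?N \<le> card S" if "S \<subseteq> tiles X f J n" "connectedin X (\<Union>S)" "\<Union>S \<inter> E \<noteq> {}"
          "\<Union>S \<inter> B \<noteq> {}" "\<Union>S \<inter> B' \<noteq> {}" for S
          using that EBB finite_subset[OF that(1) tiles(1)] by (intro D_le_card) auto
      qed
      then have "?N * (?N - 1) \<le> 4 * map_degree X A f ^ n + 2" using tiles(2) by linarith
      then have "real (?N * (?N - 1)) \<le> 4 * ?d ^ n + 2"
        by (metis (mono_tags, lifting) of_nat_add of_nat_le_iff of_nat_mult of_nat_numeral of_nat_power)
      also have "?d ^ n = ?x ^ 2"
        using d by (simp add: powr_realpow[symmetric] powr_powr flip: powr_numeral)
      finally have up: "real (?N * (?N - 1)) \<le> 4 * ?x ^ 2 + 2" .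
      show ?thesis
      proof (rule ccontr)
        \<comment> \<open>The constant 4 leaves room: a larger value would give
          \<open>12 * ?x ^ 2 \<le> 4 * ?x + 2\<close>, while the right-hand side is at most
          \<open>6 * ?x ^ 2\<close> because \<open>?x \<ge> 1\<close>.\<close>
        assume "\<not> ?thesis"
        then have N: "real ?N > 4 * ?x" by simp
        have x: "?x \<ge> 1" by (rule powr1)
        then have "?N \<ge> 1" using N by (cases ?N) auto
        then have "real (?N * (?N - 1)) = real ?N * (real ?N - 1)" by (simp add: of_nat_diff)
        also have "\<dots> \<ge> (4 * ?x) * (4 * ?x - 1)" using N x by (intro mult_mono) auto
        finally have "(4 * ?x) * (4 * ?x - 1) \<le> 4 * ?x ^ 2 + 2" using up by linarith
        then have "12 * ?x ^ 2 \<le> 4 * ?x + 2" by (simp add: algebra_simps power2_eq_square)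
        moreover have "?x \<le> ?x ^ 2" "1 \<le> ?x ^ 2" using self_le_power[OF x, of 2] one_le_power[OF x, of 2] by simp_all
        ultimately show False by linarith
      qed
    qed
    then show ?thesis by (intro exI[of _ 4]) simp
  qed
qed

end
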